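(* Let the pair $0\le(f,n_c)\in\mathcal C([0,\infty);\mathcal S)\times\mathcal C([0,\infty))$ be the solution of $$\frac{df}{dt}=\frac{\kappa_0}{n_c}\mathcal Q[f],\quad f(0,\cdot)=f_0,\qquad \frac{dn_c}{dt}=-\frac{\kappa_0}{n_c}\int \mathcal Q[f]\,dp,\quad n_c(0)=n_0 .$$ Assume that $(f_0,n_0)>0$ is such that $n_0\ge\mathcal C(f_0)-m_2\langle f_0\rangle+\delta$ for some $\delta>0$. Then there exists a constant $\alpha>0$ depending on $m_2\langle f_0\rangle$, $m_3\langle f_0\rangle$, $n_0$ and $\delta$ such that $$\int_{\mathbb R^3}f(t,p)\,|p|\,e^{\alpha\min\{1,t^{1/5}\}|p|}\,dp\ \le\ \frac1{2\alpha},\qquad\forall\,t>0 .$$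
   Context: Radial functions on $\mathbb R^3$ are identified with functions of $r=|p|\ge0$. Line-moments: $m_k\langle f\rangle=\int_0^\infty f(r)r^k\,dr$. Collision operator. The underlying operator is $\mathcal Q[f](p)=\iint_{\mathbb R^3\times\mathbb R^3}[R(p,p_1,p_2)-R(p_1,p,p_2)-R(p_2,p_1,p)]\,dp_1dp_2$ with $R(p,p_1,p_2)=|p||p_1||p_2|\,\delta(|p|-|p_1|-|p_2|)\delta(p-p_1-p_2)[f(p_1)f(p_2)(1+f(p))-(1+f(p_1))(1+f(p_2))f(p)]$. For radial $f$ it takes the following form, with numerical factors ($8\pi^2$, $4\pi$) absorbed in the normalization of $\kappa_0$ and $n_c$. With $K(r,s)=r^2s^2(r+s)^2$, $$\mathcal Q_q[f](r)=\int_0^rK(s,r-s)f(s)f(r-s)\,ds+2\int_r^\infty K(r,s-r)f(s)f(s-r)\,ds+2f(r)\Big(\int_r^\infty K(r,s-r)f(s)\,ds-\int_0^rK(s,r-s)f(s)\,ds-\int_0^\infty K(r,s)f(s)\,ds\Big),$$ $$\mathcal L[f](r)=2\int_r^\infty K(r,s-r)f(s)\,ds-f(r)\int_0^rK(s,r-s)\,ds,$$ $$\mathcal Q[f](r):=r^{-2}\big(\mathcal Q_q[f](r)+\mathcal L[f](r)\big).$$ In the equation for $n_c$, $\int\mathcal Q[f]\,dp:=\int_0^\infty\mathcal Q[f](r)\,r^2dr$. $\kappa_0>0$ is a fixed constant. The set $\mathcal S$. It consists of all $f\in L^1(\mathbb R^3,dp)$ that are nonnegative and radially symmetric, with $m_3\langle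 f\rangle=\mathfrak h_3$, $m_8\langle f\rangle\le\mathfrak h_8$ and $\|f(\cdot)|\cdot|^2\|_{L^\infty}\le\mathfrak h_\infty$. Here $\mathfrak h_3>0$, $\mathfrak h_8:=2\mathfrak h_*+\frac{\kappa_0}{\delta}\tilde C_8\,\mathfrak h_3^{7/2}$, $\mathfrak h_*:=(\tilde C_8/\tilde c_8)^{1/2}\mathfrak h_3^{9/4}$, where $\tilde C_8,\tilde c_8>0$ are fixed universal constants such that $\int_0^\infty\mathcal Q[g](r)r^8dr\le m_3\langle g\rangle^{-1}\big(\tilde C_8\,m_3\langle g\rangle^{9/2}-\tilde c_8\,m_8\langle g\rangle^2\big)$ for all radial $g\ge0$ with finite line-moments, and $\mathfrak h_\infty$ is taken sufficiently large depending only on $\mathfrak h_3,\mathfrak h_8$. Threshold. With $c_0=\int_0^1z^2(1-z)^2dz$ and $m_3=m_3\langle f_0\rangle$, $$\mathcal C(f_0)=2\sqrt{m_3\max\Big\{\|f_0(\cdot)|\cdot|^2\|_{L^\infty},\ \frac{3\max\{m_4\langle f_0\rangle,\,C\,m_3^{5/4}\}}{2\,c_0^{1/4}m_3^{3/4}}\Big\}},$$ where $C>0$ is a fixed universal constant such that solutions satisfy $\sup_t m_4\langle f(t)\rangle\le\max\{m_4\langle f_0\rangle,C m_3^{5/4}\}$ as long as $n_c>0$. Under the threshold condition the solution satisfies $n_c(t)\ge\delta$ for all $t\ge0$. *)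

theory Defs
  imports "HOL-Analysis.Analysis" "HOL-Probability.Essential_Supremum"
begin

(* A radial function on R^3 is given by its profile f :: real => real, of which only the values
   f r with r >= 0 matter; the function on R^3 itself is p |-> f (norm p).  A profile stands for
   its class modulo null sets, so sign and size conditions are imposed almost everywhere. *)

definition radial_L1 :: "(real \<Rightarrow> real) \<Rightarrow> bool" where
  "radial_L1 f \<longleftrightarrow> integrable lborel (\<lambda>p::real^3. f (norm p))"

definition L1_norm :: "(real \<Rightarrow> real) \<Rightarrow> real" where
  "L1_norm f = (\<integral>p. \<bar>f (norm (p::real^3))\<bar> \<partial>lborel)"

definition radial_nonneg :: "(real \<Rightarrow> real) \<Rightarrow> bool" where
  "radial_nonneg f \<longleftrightarrow> (AE p in lborel. 0 \<le> f (norm (p::real^3)))"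

definition weighted_Linf_norm :: "(real \<Rightarrow> real) \<Rightarrow> ereal" where
  "weighted_Linf_norm f = esssup lborel (\<lambda>p::real^3. ereal \<bar>f (norm p) * (norm p)\<^sup>2\<bar>)"

definition has_moment :: "nat \<Rightarrow> (real \<Rightarrow> real) \<Rightarrow> bool" where
  "has_moment k f \<longleftrightarrow> set_integrable lborel {0..} (\<lambda>r. f r * r ^ k)"

definition moment :: "nat \<Rightarrow> (real \<Rightarrow> real) \<Rightarrow> real" where
  "moment k f = (LBINT r:{0..}. f r * r ^ k)"

definition K :: "real \<Rightarrow> real \<Rightarrow> real" where
  "K r s = r\<^sup>2 * s\<^sup>2 * (r + s)\<^sup>2"

definition Q_quad :: "(real \<Rightarrow> real) \<Rightarrow> real \<Rightarrow> real" where
  "Q_quad f r =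
     (LBINT s:{0..r}. K s (r - s) * f s * f (r - s))
     + 2 * (LBINT s:{r..}. K r (s - r) * f s * f (s - r))
     + 2 * f r * ((LBINT s:{r..}. K r (s - r) * f s)
                  - (LBINT s:{0..r}. K s (r - s) * f s)
                  - (LBINT s:{0..}. K r s * f s))"

definition L_lin :: "(real \<Rightarrow> real) \<Rightarrow> real \<Rightarrow> real" where
  "L_lin f r = 2 * (LBINT s:{r..}. K r (s - r) * f s) - f r * (LBINT s:{0..r}. K s (r - s))"

definition Q :: "(real \<Rightarrow> real) \<Rightarrow> real \<Rightarrow> real" where
  "Q f r = (Q_quad f r + L_lin f r) / r\<^sup>2"

(* The bound hinf is a free parameter: being "sufficiently large depending on h3 and h8" is a
   requirement of the existence theory, and enlarging hinf only enlarges the set. *)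
definition S_set :: "real \<Rightarrow> real \<Rightarrow> real \<Rightarrow> (real \<Rightarrow> real) set" where
  "S_set h3 h8 hinf = {f. radial_L1 f \<and> radial_nonneg f \<and>
     has_moment 3 f \<and> moment 3 f = h3 \<and>
     has_moment 8 f \<and> moment 8 f \<le> h8 \<and>
     weighted_Linf_norm f \<le> ereal hinf}"

definition h_star :: "real \<Rightarrow> real \<Rightarrow> real \<Rightarrow> real" where
  "h_star C\<^sub>8 c\<^sub>8 h3 = (C\<^sub>8 / c\<^sub>8) powr (1/2) * h3 powr (9/4)"

definition h_8 :: "real \<Rightarrow> real \<Rightarrow> real \<Rightarrow> real \<Rightarrow> real \<Rightarrow> real" where
  "h_8 \<kappa> C\<^sub>8 c\<^sub>8 \<delta> h3 = 2 * h_star C\<^sub>8 c\<^sub>8 h3 + \<kappa> / \<delta> * C\<^sub>8 * h3 powr (7/2)"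

(* The integral of Q g against r^8 dr is moment 8 (Q g).  If moment 3 g = 0 then g = 0 almost
   everywhere and the inequality reads 0 <= 0. *)
definition m8_constants :: "real \<Rightarrow> real \<Rightarrow> bool" where
  "m8_constants C\<^sub>8 c\<^sub>8 \<longleftrightarrow> 0 < C\<^sub>8 \<and> 0 < c\<^sub>8 \<and>
     (\<forall>g. radial_nonneg g \<and> (\<forall>k. has_moment k g) \<longrightarrow>
        moment 8 (Q g)
          \<le> inverse (moment 3 g) * (C\<^sub>8 * moment 3 g powr (9/2) - c\<^sub>8 * (moment 8 g)\<^sup>2))"

(* Continuity and differentiability in time are those of curves in L^1(R^3,dp). *)
definition L1_continuous_on :: "real set \<Rightarrow> (real \<Rightarrow> real \<Rightarrow> real) \<Rightarrow> bool" where
  "L1_continuous_on I f \<longleftrightarrow>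
     (\<forall>t\<in>I. radial_L1 (f t) \<and>
        ((\<lambda>s. L1_norm (\<lambda>r. f s r - f t r)) \<longlongrightarrow> 0) (at t within I))"

definition has_L1_derivative ::
    "(real \<Rightarrow> real \<Rightarrow> real) \<Rightarrow> (real \<Rightarrow> real) \<Rightarrow> real \<Rightarrow> real set \<Rightarrow> bool" where
  "has_L1_derivative f g t I \<longleftrightarrow> radial_L1 g \<and>
     ((\<lambda>s. L1_norm (\<lambda>r. (f s r - f t r) / (s - t) - g r)) \<longlongrightarrow> 0) (at t within I)"

(* Solutions on a time interval I that starts at 0, with values in S.  The equations are imposed
   at positive times only.  The total mass exchange, the integral of Q[f] dp, is by convention
   the line integral against r^2 dr, i.e. moment 2 (Q (f t)). *)
definition solution ::
    "real \<Rightarrow> (real \<Rightarrow> real) set \<Rightarrow> real set \<Rightarrow> (real \<Rightarrow> real) \<Rightarrow> real \<Rightarrow>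
     (real \<Rightarrow> real \<Rightarrow> real) \<Rightarrow> (real \<Rightarrow> real) \<Rightarrow> bool" where
  "solution \<kappa> S I f0 n0 f nc \<longleftrightarrow>
     (\<forall>t\<in>I. f t \<in> S) \<and> L1_continuous_on I f \<and>
     (\<forall>t\<in>I. 0 \<le> nc t) \<and> continuous_on I nc \<and>
     f 0 = f0 \<and> nc 0 = n0 \<and>
     (\<forall>t\<in>I. 0 < t \<longrightarrow>
        has_L1_derivative f (\<lambda>r. \<kappa> / nc t * Q (f t) r) t I \<and>
        (nc has_real_derivative - (\<kappa> / nc t) * moment 2 (Q (f t))) (at t within I))"

(* The constant C of the propagation estimate for the fourth moment.  Being universal, it serves
   all kinetic constants, all sets S and all solutions for as long as nc stays positive. *)
definition m4_constant :: "real \<Rightarrow> bool" where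
  "m4_constant C \<longleftrightarrow> 0 < C \<and>
     (\<forall>\<kappa> h3 h8 hinf T f0 n0 f nc.
        0 < \<kappa> \<and> 0 < h3 \<and> 0 < T \<and> solution \<kappa> (S_set h3 h8 hinf) {0..<T} f0 n0 f nc \<and>
        (\<forall>t\<in>{0..<T}. 0 < nc t) \<longrightarrow>
        (\<forall>t\<in>{0..<T}. moment 4 (f t) \<le> max (moment 4 f0) (C * moment 3 f0 powr (5/4))))"

definition c_0 :: real where
  "c_0 = (LBINT z:{0..1}. z\<^sup>2 * (1 - z)\<^sup>2)"

(* real_of_ereal is harmless: the norm is finite for f0 in S. *)
definition threshold :: "real \<Rightarrow> (real \<Rightarrow> real) \<Rightarrow> real" where
  "threshold C f0 =
     2 * sqrt (moment 3 f0 *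
       max (real_of_ereal (weighted_Linf_norm f0))
           (3 * max (moment 4 f0) (C * moment 3 f0 powr (5/4))
             / (2 * c_0 powr (1/4) * moment 3 f0 powr (3/4))))"

end

(* With g_N(r) = exp(theta min(r, N)) the weight phi(r) = r g_N(r) is superadditive, and since the
   third moment is conserved, testing with phi amounts to testing with the bounded function
   r (g_N(r) - exp(theta N)).  In the weak form of the collision operator the cubic terms then have
   a sign, the quadratic gain is at most theta E_3 E_5, and the linear loss controls a full
   moment of order 8.  Five powers of r are gained over E_3, so an exponent theta growing
   like t^(1/5) is absorbed; all bounds are uniform in N.

   Mass conservation bounds n_c from above, hence
   the rate kappa / n_c from below while n_c > 0, and the bounded mass flux keeps n_c positive up to a
   time T0 fixed by the data.  The exponent grows until T0 and is frozen afterwards; from then on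
   only the sign of the rate matters (it is 0 where n_c = 0, as 1 / 0 = 0). *)
theory Submission
  imports Defs
begin

section \<open>Radial integration and shear maps\<close>

text \<open>The power 1/5 comes from a balance. If \<theta> has slope \<mu> in time, its growth
  costs \<mu> times a moment with weight r^4 exp(\<theta> r), while the linear loss supplies the
  rate times a moment with weight r^8 exp(\<theta> r). The loss wins where r^4 exceeds \<mu> divided
  by the rate. On the remaining region the exponential has to be harmless, \<theta> r <= 1, and this
  asks that \<mu> \<theta>^4 be at most a multiple of the rate. With \<theta> = e reached at time t
  with slope \<mu> = e / t, the condition reads e^5 <= const t.

  The gain \<theta> E_3 E_5 is superlinear, so a linear Gronwall estimate does not close. It becomes
  a small part of the loss once \<theta> E_3 is small, because E_5 <= E_3 + E_8. Since this
  presupposes a bound on E_3, the differential inequality is used only while E_3 lies between two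
  levels; above the lower one, E_8 is large enough for the loss to dominate.

  Test functions have to be bounded because the time derivative of f is a limit in L^1 only.\<close>

lemma distr_norm_R3:
  "distr (lborel :: (real^3) measure) borel norm
     = density lborel (\<lambda>r. ennreal (4 * pi * r\<^sup>2 * indicator {0..} r))"
proof (rule measure_eqI_generator_eq[where E = "range atMost" and \<Omega> = UNIV and A = "\<lambda>i. {..real i}"])
  have s: "sets (borel :: real measure) = sigma_sets UNIV (range atMost)"
    by (subst borel_eq_atMost) simp
  show "sets (distr (lborel :: (real^3) measure) borel norm) = sigma_sets UNIV (range atMost)"
    "sets (density lborel (\<lambda>r. ennreal (4 * pi * r\<^sup>2 * indicator {0..} r))) = sigma_sets UNIV (range atMost)"
    by (simp_all add: s)
  \<comment> \<open>Polar coordinates for radial functions: under both measures a half-line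
    \<open>{..a}\<close> has the volume 4/3 pi a^3 of a ball, and the half-lines are an
    intersection-stable generator of the Borel sets.\<close>
  have e1: "emeasure (distr (lborel :: (real^3) measure) borel norm) {..a}
      = ennreal (if a \<ge> 0 then 4/3 * pi * a ^ 3 else 0)" for a :: real
  proof -
    have "norm -` {..a} \<inter> space (lborel :: (real^3) measure) = cball 0 a"
      by (auto simp: dist_norm)
    then show ?thesis
      by (cases "a \<ge> 0") (simp_all add: emeasure_distr emeasure_cball unit_ball_vol_3)
  qed
  show "emeasure (distr (lborel :: (real^3) measure) borel norm) X =
        emeasure (density lborel (\<lambda>r. ennreal (4 * pi * r\<^sup>2 * indicator {0..} r))) X"
    if X: "X \<in> range atMost" for X
  proof -
    obtain a where a: "X = {..a}" using X by auto
    have "emeasure (density lborel (\<lambda>r. ennreal (4 * pi * r\<^sup>2 * indicator {0..} r))) X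
        = (\<integral>\<^sup>+r. ennreal (4 * pi * r\<^sup>2) * indicator {0..a} r \<partial>lborel)"
      unfolding a by (subst emeasure_density)
        (auto intro!: nn_integral_cong simp: indicator_def)
    also have "\<dots> = ennreal (if a \<ge> 0 then 4/3 * pi * a ^ 3 else 0)"
    proof (cases "a \<ge> 0")
      case True
      have "(\<integral>\<^sup>+r. ennreal (4 * pi * r\<^sup>2) * indicator {0..a} r \<partial>lborel)
          = ennreal (4/3 * pi * a ^ 3 - 4/3 * pi * 0 ^ 3)"
        by (rule nn_integral_FTC_Icc) (use True in \<open>auto intro!: derivative_eq_intros\<close>)
      with True show ?thesis by simp
    qed simp
    finally show ?thesis using e1 a by simp
  qed
  show "emeasure (distr (lborel :: (real^3) measure) borel norm) {..real i} \<noteq> \<infinity>" for i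
    by (simp add: e1)
  show "(\<Union>i. {..real i}) = UNIV"
    by (auto simp: real_arch_simple)
  show "Int_stable (range (atMost :: real \<Rightarrow> real set))"
    by (auto simp: Int_stable_def)
qed auto

text \<open>Restriction to the ray spanned by a unit vector. A ray is a null set, but measurability
  for \<open>lborel\<close> is Borel measurability and survives the restriction. At negative
  arguments \<open>F\<close> is arbitrary, hence the indicator.\<close>

lemma profile_measurable:
  fixes F :: "real \<Rightarrow> real"
  assumes "(\<lambda>p::real^3. F (norm p)) \<in> borel_measurable lborel"
  shows "(\<lambda>r. indicator {0..} r * F r) \<in> borel_measurable borel"
proof -
  obtain e :: "real^3" where e: "norm e = 1" using vector_choose_size[of 1] by auto
  have "(\<lambda>r. F (norm (r *\<^sub>R e))) \<in> borel_measurable borel"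
    by (rule measurable_compose[OF _ assms[unfolded measurable_lborel1]]) simp
  then have "(\<lambda>r. indicator {0..} r * F (norm (r *\<^sub>R e))) \<in> borel_measurable borel"
    by (intro borel_measurable_times) auto
  also have "(\<lambda>r. indicator {0..} r * F (norm (r *\<^sub>R e))) = (\<lambda>r. indicator {0..} r * F r)"
    using e by (auto simp: indicator_def)
  finally show ?thesis .
qed

text \<open>The radial density 4 pi r^2 is positive for r > 0, so null sets descend from space to
  the half-line; only the origin, where it vanishes, is lost.\<close>

lemma AE_norm_R3:
  "(AE p in (lborel :: (real^3) measure). P (norm p)) \<Longrightarrow> {r. 0 \<le> r \<and> P r} \<in> sets borel
    \<Longrightarrow> AE r in lborel. 0 < r \<longrightarrow> P r"
proof -
  assume P: "AE p in (lborel :: (real^3) measure). P (norm p)" and m: "{r. 0 \<le> r \<and> P r} \<in> sets borel"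
  have "AE r in distr (lborel :: (real^3) measure) borel norm. 0 \<le> r \<and> P r"
    by (subst AE_distr_iff) (use P m in auto)
  then have "AE r in lborel. 0 < ennreal (4 * pi * r\<^sup>2 * indicator {0..} r) \<longrightarrow> 0 \<le> r \<and> P r"
    unfolding distr_norm_R3 by (subst (asm) AE_density) auto
  then show ?thesis
    by (rule AE_mp) (auto intro!: AE_I2 simp: indicator_def)
qed

lemma nn_integral_norm_R3:
  assumes [measurable]: "F \<in> borel_measurable borel"
  shows "(\<integral>\<^sup>+p. F (norm (p::real^3)) \<partial>lborel)
     = (\<integral>\<^sup>+r. ennreal (4 * pi * r\<^sup>2 * indicator {0..} r) * F r \<partial>lborel)"
proof -
  have "(\<integral>\<^sup>+p. F (norm (p::real^3)) \<partial>lborel) = (\<integral>\<^sup>+r. F r \<partial>distr (lborel :: (real^3) measure) borel norm)"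
    by (subst nn_integral_distr) auto
  also have "\<dots> = (\<integral>\<^sup>+r. ennreal (4 * pi * r\<^sup>2 * indicator {0..} r) * F r \<partial>lborel)"
    unfolding distr_norm_R3 by (subst nn_integral_density) auto
  finally show ?thesis .
qed

lemma
  fixes F :: "real \<Rightarrow> real"
  assumes F: "(\<lambda>p::real^3. F (norm p)) \<in> borel_measurable lborel"
  shows integrable_norm_R3:
    "integrable lborel (\<lambda>p::real^3. F (norm p)) \<longleftrightarrow> set_integrable lborel {0..} (\<lambda>r. F r * r\<^sup>2)" (is ?A)
    and integral_norm_R3:
    "(\<integral>p. F (norm (p::real^3)) \<partial>lborel) = 4 * pi * (LBINT r:{0..}. F r * r\<^sup>2)" (is ?B)
proof -
  define G where "G r = indicator {0..} r * F r" for r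
  have [measurable]: "G \<in> borel_measurable borel"
    unfolding G_def by (rule profile_measurable[OF F])
  have G: "F (norm p) = G (norm p)" for p :: "real^3" by (simp add: G_def)
  have eq: "(4 * pi * r\<^sup>2 * indicator {0..} r) *\<^sub>R G r = 4 * pi * (indicator {0..} r *\<^sub>R (F r * r\<^sup>2))" for r
    by (auto simp: G_def indicator_def)
  have "integrable lborel (\<lambda>p::real^3. G (norm p)) \<longleftrightarrow> integrable (distr (lborel :: (real^3) measure) borel norm) G"
    by (subst integrable_distr_eq) auto
  also have "\<dots> \<longleftrightarrow> integrable lborel (\<lambda>r. (4 * pi * r\<^sup>2 * indicator {0..} r) *\<^sub>R G r)"
    unfolding distr_norm_R3 by (subst integrable_density) auto
  also have "\<dots> \<longleftrightarrow> set_integrable lborel {0..} (\<lambda>r. F r * r\<^sup>2)"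
    unfolding eq set_integrable_def by simp
  finally show ?A by (simp add: G)
  have "(\<integral>p. G (norm (p::real^3)) \<partial>lborel) = integral\<^sup>L (distr (lborel :: (real^3) measure) borel norm) G"
    by (subst integral_distr) auto
  also have "\<dots> = integral\<^sup>L lborel (\<lambda>r. (4 * pi * r\<^sup>2 * indicator {0..} r) *\<^sub>R G r)"
    unfolding distr_norm_R3 by (subst integral_density) auto
  also have "\<dots> = 4 * pi * (LBINT r:{0..}. F r * r\<^sup>2)"
    unfolding eq set_lebesgue_integral_def by simp
  finally show ?B by (simp add: G)
qed

text \<open>By Fubini this is translation invariance on each fibre. The shear turns the arguments s
  and r - s of the collision integrals into independent variables x and y with r = x + y.\<close>

lemma distr_shear:
  "distr (lborel \<Otimes>\<^sub>M lborel) (lborel \<Otimes>\<^sub>M lborel) (\<lambda>(x, y). (x, x + y :: real)) = lborel \<Otimes>\<^sub>M lborel"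
proof (rule measure_eqI)
  fix A assume "A \<in> sets (distr (lborel \<Otimes>\<^sub>M lborel) (lborel \<Otimes>\<^sub>M lborel) (\<lambda>(x, y). (x, x + y :: real)))"
  then have A: "A \<in> sets (lborel \<Otimes>\<^sub>M lborel)" by simp
  have [measurable]: "(indicator A :: real \<times> real \<Rightarrow> ennreal) \<in> borel_measurable (lborel \<Otimes>\<^sub>M lborel)"
    using A by simp
  have "emeasure (distr (lborel \<Otimes>\<^sub>M lborel) (lborel \<Otimes>\<^sub>M lborel) (\<lambda>(x, y). (x, x + y :: real))) A
      = (\<integral>\<^sup>+z. indicator A z \<partial>distr (lborel \<Otimes>\<^sub>M lborel) (lborel \<Otimes>\<^sub>M lborel) (\<lambda>(x, y). (x, x + y :: real)))"
    using A by simp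
  also have "\<dots> = (\<integral>\<^sup>+z. indicator A (fst z, fst z + snd z) \<partial>(lborel \<Otimes>\<^sub>M lborel))"
    by (subst nn_integral_distr) (auto simp: case_prod_beta')
  also have "\<dots> = (\<integral>\<^sup>+x. \<integral>\<^sup>+y. indicator A (x, x + y) \<partial>lborel \<partial>lborel)"
    by (subst lborel.nn_integral_fst[symmetric]) auto
  also have "\<dots> = (\<integral>\<^sup>+x. \<integral>\<^sup>+y. indicator A (x, y) \<partial>lborel \<partial>lborel)"
  proof (rule nn_integral_cong)
    fix x :: real
    have "(\<integral>\<^sup>+y. indicator A (x, y) \<partial>lborel) = (\<integral>\<^sup>+y. (indicator A (x, y) :: ennreal) \<partial>distr lborel borel ((+) x))"
      by (subst lborel_distr_plus) simp
    also have "\<dots> = (\<integral>\<^sup>+y. indicator A (x, x + y) \<partial>lborel)"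
      by (subst nn_integral_distr) auto
    finally show "(\<integral>\<^sup>+y. indicator A (x, x + y) \<partial>lborel) = (\<integral>\<^sup>+y. (indicator A (x, y) :: ennreal) \<partial>lborel)" ..
  qed
  also have "\<dots> = emeasure (lborel \<Otimes>\<^sub>M lborel) A"
    by (subst lborel.nn_integral_fst) (use A in auto)
  finally show "emeasure (distr (lborel \<Otimes>\<^sub>M lborel) (lborel \<Otimes>\<^sub>M lborel) (\<lambda>(x, y). (x, x + y :: real))) A
      = emeasure (lborel \<Otimes>\<^sub>M lborel) A" .
qed simp

lemma
  fixes F :: "real \<Rightarrow> real \<Rightarrow> real"
  assumes F: "integrable (lborel \<Otimes>\<^sub>M lborel) (\<lambda>(x, y). F x y)"
  shows integrable_shear: "integrable (lborel \<Otimes>\<^sub>M lborel) (\<lambda>(x, s). F x (s - x))" (is ?A)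
    and integral_shear: "(\<integral>(x, s). F x (s - x) \<partial>(lborel \<Otimes>\<^sub>M lborel)) = (\<integral>(x, y). F x y \<partial>(lborel \<Otimes>\<^sub>M lborel))" (is ?B)
proof -
  have m [measurable]: "(\<lambda>(x, s). F x (s - x)) \<in> borel_measurable (lborel \<Otimes>\<^sub>M lborel)"
    using measurable_compose[OF _ borel_measurable_integrable[OF F],
        of "\<lambda>z. (fst z, snd z - fst z)" "lborel \<Otimes>\<^sub>M lborel"] by (simp add: case_prod_beta')
  have 1: "(\<lambda>z. (\<lambda>(x, s). F x (s - x)) ((\<lambda>(x, y). (x, x + y)) z)) = (\<lambda>(x, y). F x y)"
    by (auto simp: fun_eq_iff)
  have "integrable (distr (lborel \<Otimes>\<^sub>M lborel) (lborel \<Otimes>\<^sub>M lborel) (\<lambda>(x, y). (x, x + y))) (\<lambda>(x, s). F x (s - x))"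
    by (subst integrable_distr_eq) (use F m in \<open>auto simp del: split_beta simp: 1\<close>)
  then show ?A unfolding distr_shear .
  have "integral\<^sup>L (distr (lborel \<Otimes>\<^sub>M lborel) (lborel \<Otimes>\<^sub>M lborel) (\<lambda>(x, y). (x, x + y))) (\<lambda>(x, s). F x (s - x))
     = (\<integral>(x, y). F x y \<partial>(lborel \<Otimes>\<^sub>M lborel))"
    by (subst integral_distr) (use m in \<open>auto simp del: split_beta simp: 1\<close>)
  then show ?B unfolding distr_shear .
qed

section \<open>Weak form of the collision operator\<close>

lemma integrable_unshear:
  fixes H :: "real \<Rightarrow> real \<Rightarrow> real"
  assumes H: "integrable (lborel \<Otimes>\<^sub>M lborel) (\<lambda>(x, s). H x s)"
  shows "integrable (lborel \<Otimes>\<^sub>M lborel) (\<lambda>(x, y). H x (x + y))"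
proof -
  have "integrable (distr (lborel \<Otimes>\<^sub>M lborel) (lborel \<Otimes>\<^sub>M lborel) (\<lambda>(x, y). (x, x + y))) (\<lambda>(x, s). H x s)"
    unfolding distr_shear by (rule H)
  from integrable_distr[OF _ this] show ?thesis
    by (simp add: case_prod_beta')
qed

lemma
  fixes h k :: "real \<Rightarrow> real"
  assumes h: "integrable lborel h" and k: "integrable lborel k"
  shows integrable_times_lborel: "integrable (lborel \<Otimes>\<^sub>M lborel) (\<lambda>(x, y). h x * k y)" (is ?A)
    and integral_times_lborel:
      "(\<integral>(x, y). h x * k y \<partial>(lborel \<Otimes>\<^sub>M lborel)) = integral\<^sup>L lborel h * integral\<^sup>L lborel k" (is ?B)
proof -
  have [measurable]: "h \<in> borel_measurable borel" "k \<in> borel_measurable borel"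
    using borel_measurable_integrable[OF h] borel_measurable_integrable[OF k] by auto
  show ?A
    by (rule lborel_pair.Fubini_integrable) (use h k in \<open>auto simp: abs_mult\<close>)
  from lborel_pair.integral_fst'[OF this] show ?B by simp
qed

lemma integrable_times_bounded:
  fixes F g :: "'a \<Rightarrow> real"
  assumes F: "integrable M F" and g: "g \<in> borel_measurable M" "\<And>x. \<bar>g x\<bar> \<le> C"
  shows "integrable M (\<lambda>x. F x * g x)"
proof (rule Bochner_Integration.integrable_bound)
  show "integrable M (\<lambda>x. C * F x)" using F by simp
  show "AE x in M. norm (F x * g x) \<le> norm (C * F x)"
  proof (rule AE_I2)
    fix x show "norm (F x * g x) \<le> norm (C * F x)"
      using mult_left_mono[of "\<bar>g x\<bar>" "\<bar>C\<bar>" "\<bar>F x\<bar>"] g(2)[of x] by (auto simp: abs_mult mult.commute)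
  qed
qed (use g borel_measurable_integrable[OF F] in auto)

section \<open>Profiles on the half-line and integrability of the collision densities\<close>

abbreviation pos :: "real \<Rightarrow> real" where "pos \<equiv> indicator {0<..}"

lemma K_measurable [measurable]:
  assumes [measurable]: "f \<in> borel_measurable M" "g \<in> borel_measurable M"
  shows "(\<lambda>x. K (f x) (g x)) \<in> borel_measurable M"
  unfolding K_def by measurable

lemma K_nonneg: "0 \<le> K x y" by (simp add: K_def)

lemma power_between:
  fixes r :: real
  assumes "0 < r" "2 \<le> k" "k \<le> 8"
  shows "r ^ k \<le> r ^ 2 + r ^ 8"
proof (cases "r \<le> 1")
  case True
  then have "r ^ k \<le> r ^ 2" using assms by (intro power_decreasing) auto
  then show ?thesis using assms(1) by (auto intro: add_increasing2)
next
  case False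
  then have "r ^ k \<le> r ^ 8" using assms by (intro power_increasing) auto
  then show ?thesis by (auto intro: add_increasing)
qed

text \<open>Vanishing for r <= 0 replaces all set integrals by integrals over the whole line.
  Moments 2 and 8 are what L^1(R^3) and the solution space provide; they dominate every moment in
  between.\<close>

locale profile =
  fixes u :: "real \<Rightarrow> real"
  assumes u_measurable [measurable]: "u \<in> borel_measurable borel"
    and u_nonneg: "\<And>r. 0 \<le> u r"
    and u_zero: "\<And>r. r \<le> 0 \<Longrightarrow> u r = 0"
    and u_integrable2: "integrable lborel (\<lambda>r. u r * r ^ 2)"
    and u_integrable8: "integrable lborel (\<lambda>r. u r * r ^ 8)"
begin

lemma integrable_weight:
  assumes [measurable]: "h \<in> borel_measurable borel"
    and h: "\<And>r. 0 < r \<Longrightarrow> \<bar>h r\<bar> \<le> C * (r ^ 2 + r ^ 8)"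
  shows "integrable lborel (\<lambda>r. u r * h r)"
proof (rule Bochner_Integration.integrable_bound)
  show "integrable lborel (\<lambda>r. C * (u r * r ^ 2 + u r * r ^ 8))"
    using u_integrable2 u_integrable8 by simp
  show "AE r in lborel. norm (u r * h r) \<le> norm (C * (u r * r ^ 2 + u r * r ^ 8))"
  proof (rule AE_I2)
    fix r show "norm (u r * h r) \<le> norm (C * (u r * r ^ 2 + u r * r ^ 8))"
    proof (cases "0 < r")
      case True
      have "u r * \<bar>h r\<bar> \<le> u r * (C * (r ^ 2 + r ^ 8))"
        by (rule mult_left_mono[OF h[OF True] u_nonneg])
      also have "\<dots> = C * (u r * r ^ 2 + u r * r ^ 8)" by (simp add: algebra_simps)
      also have "\<dots> \<le> norm (C * (u r * r ^ 2 + u r * r ^ 8))" by simp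
      finally show ?thesis using u_nonneg[of r] by (simp add: abs_mult)
    qed (simp add: u_zero)
  qed
qed auto

lemma integrable_power: "2 \<le> k \<Longrightarrow> k \<le> 8 \<Longrightarrow> integrable lborel (\<lambda>r. u r * r ^ k)"
  by (rule integrable_weight[where C = 1]) (use power_between in auto)

text \<open>Densities of the three groups of terms in the weak form: the products \<open>f(x) f(y)\<close>,
  \<open>f(x + y) (f(x) + f(y))\<close> (half of it, by symmetry) and \<open>f(x + y)\<close>.\<close>

definition P1 :: "real \<Rightarrow> real \<Rightarrow> real" where "P1 x y = K x y * u x * u y"
definition P2 :: "real \<Rightarrow> real \<Rightarrow> real" where "P2 x y = K x y * u (x + y) * u x * pos y"
definition P3 :: "real \<Rightarrow> real \<Rightarrow> real" where "P3 x y = K x y * u (x + y) * pos x * pos y"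

lemma P_measurable [measurable]:
  assumes [measurable]: "f \<in> borel_measurable M" "g \<in> borel_measurable M"
  shows "(\<lambda>x. P1 (f x) (g x)) \<in> borel_measurable M" "(\<lambda>x. P2 (f x) (g x)) \<in> borel_measurable M"
    "(\<lambda>x. P3 (f x) (g x)) \<in> borel_measurable M"
  unfolding P1_def P2_def P3_def by measurable

lemma P_nonneg: "0 \<le> P1 x y" "0 \<le> P2 x y" "0 \<le> P3 x y"
  using u_nonneg by (auto simp: P1_def P2_def P3_def K_nonneg)

lemma integrable_P1: "integrable (lborel \<Otimes>\<^sub>M lborel) (\<lambda>(x, y). P1 x y)"
proof (rule Bochner_Integration.integrable_bound)
  show "integrable (lborel \<Otimes>\<^sub>M lborel) (\<lambda>z. 2 * (case z of (x, y) \<Rightarrow> (u x * x ^ 4) * (u y * y ^ 2))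
     + 2 * (case z of (x, y) \<Rightarrow> (u x * x ^ 2) * (u y * y ^ 4)))"
    by (intro Bochner_Integration.integrable_add integrable_mult_right integrable_times_lborel integrable_power) auto
  have "P1 x y \<le> 2 * ((u x * x ^ 4) * (u y * y ^ 2)) + 2 * ((u x * x ^ 2) * (u y * y ^ 4))" for x y
  proof -
    have "K x y \<le> 2 * (x ^ 4 * y ^ 2) + 2 * (x ^ 2 * y ^ 4)"
    proof -
      have "(x + y)\<^sup>2 \<le> 2 * x\<^sup>2 + 2 * y\<^sup>2"
        using zero_le_power2[of "x - y"] by (simp add: power2_eq_square algebra_simps)
      then have "(x\<^sup>2 * y\<^sup>2) * (x + y)\<^sup>2 \<le> (x\<^sup>2 * y\<^sup>2) * (2 * x\<^sup>2 + 2 * y\<^sup>2)"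
        by (rule mult_left_mono) simp
      also have "\<dots> = 2 * (x ^ 4 * y ^ 2) + 2 * (x ^ 2 * y ^ 4)"
        by algebra
      finally show ?thesis by (simp add: K_def)
    qed
    then have "K x y * (u x * u y) \<le> (2 * (x ^ 4 * y ^ 2) + 2 * (x ^ 2 * y ^ 4)) * (u x * u y)"
      by (rule mult_right_mono) (simp add: u_nonneg)
    then show ?thesis by (simp add: P1_def algebra_simps)
  qed
  then show "AE z in lborel \<Otimes>\<^sub>M lborel. norm (case z of (x, y) \<Rightarrow> P1 x y) \<le> norm (2 * (case z of (x, y) \<Rightarrow> (u x * x ^ 4) * (u y * y ^ 2))
     + 2 * (case z of (x, y) \<Rightarrow> (u x * x ^ 2) * (u y * y ^ 4)))"
    by (intro AE_I2) (auto simp: P_nonneg split: prod.splits intro: order_trans[OF _ abs_ge_self])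
qed (simp add: case_prod_beta')

text \<open>Bounding y by x + y leaves a product of a function of x and a function of x + y, which
  the shear separates into two moments.\<close>

lemma P2_le: "P2 x y \<le> (u x * x ^ 2) * (u (x + y) * (x + y) ^ 4)"
proof (cases "0 < x \<and> 0 < y")
  case True
  then have "y ^ 2 \<le> (x + y) ^ 2" by (intro power_mono) auto
  then have "x\<^sup>2 * y\<^sup>2 * (x + y)\<^sup>2 \<le> x\<^sup>2 * (x + y)\<^sup>2 * (x + y)\<^sup>2"
    by (intro mult_mono) auto
  also have "\<dots> = x\<^sup>2 * (x + y) ^ 4" by algebra
  finally have "K x y * (u (x + y) * u x) \<le> (x\<^sup>2 * (x + y) ^ 4) * (u (x + y) * u x)"
    unfolding K_def by (rule mult_right_mono) (simp add: u_nonneg)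
  then show ?thesis using True by (simp add: P2_def algebra_simps)
qed (auto simp: P2_def u_zero u_nonneg not_less)

lemma integrable_P2_bound:
  "integrable (lborel \<Otimes>\<^sub>M lborel) (\<lambda>(x, y). (u x * x ^ 2) * (u (x + y) * (x + y) ^ 4))"
  by (rule integrable_unshear[where H = "\<lambda>x s. (u x * x ^ 2) * (u s * s ^ 4)"])
    (intro integrable_times_lborel integrable_power; simp)

lemma integrable_P2: "integrable (lborel \<Otimes>\<^sub>M lborel) (\<lambda>(x, y). P2 x y)"
  by (rule Bochner_Integration.integrable_bound[OF integrable_P2_bound])
    (auto intro!: AE_I2 simp: case_prod_beta' P_nonneg intro: order_trans[OF P2_le abs_ge_self])

text \<open>Only one factor \<open>u\<close> is present, so everything is expressed through s = x +
  y; the free variable x then ranges over (0, s) and contributes one more power, which ends in the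
  seventh moment.\<close>

lemma P3_le: "P3 x y \<le> u (x + y) * (x + y) ^ 6 * pos x * pos y"
proof (cases "0 < x \<and> 0 < y")
  case True
  then have "x ^ 2 \<le> (x + y) ^ 2" "y ^ 2 \<le> (x + y) ^ 2" by (auto intro!: power_mono)
  then have "x\<^sup>2 * y\<^sup>2 * (x + y)\<^sup>2 \<le> (x + y)\<^sup>2 * (x + y)\<^sup>2 * (x + y)\<^sup>2"
    by (intro mult_mono) auto
  also have "\<dots> = (x + y) ^ 6" by algebra
  finally have "K x y * u (x + y) \<le> (x + y) ^ 6 * u (x + y)"
    unfolding K_def by (rule mult_right_mono) (simp add: u_nonneg)
  then show ?thesis using True by (simp add: P3_def algebra_simps)
qed (auto simp: P3_def)

text \<open>For fixed c the indicators restrict s to (0, c), an interval of length c, so that c^6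
  becomes c^7.\<close>

lemma
  shows integrable_P3_sheared:
      "integrable (lborel \<Otimes>\<^sub>M lborel) (\<lambda>(c, s). u c * c ^ 6 * pos s * pos (c - s))" (is ?A)
    and integral_P3_sheared:
      "(\<integral>(c, s). u c * c ^ 6 * pos s * pos (c - s) \<partial>(lborel \<Otimes>\<^sub>M lborel)) = (\<integral>c. u c * c ^ 7 \<partial>lborel)" (is ?B)
proof -
  have eq: "u c * c ^ 6 * pos s * pos (c - s) = u c * c ^ 6 * indicator {0<..<c} s" for c s
    by (auto simp: indicator_def)
  have inner: "(\<integral>s. u c * c ^ 6 * pos s * pos (c - s) \<partial>lborel) = u c * c ^ 7" for c
    unfolding eq by (cases "0 < c") (auto simp: u_zero power_Suc[symmetric] eval_nat_numeral)
  have abs: "\<bar>u c * c ^ 6 * pos s * pos (c - s)\<bar> = u c * c ^ 6 * pos s * pos (c - s)" for c s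
    by (rule abs_of_nonneg) (simp add: u_nonneg)
  show ?A
  proof (rule lborel_pair.Fubini_integrable)
    show "integrable lborel (\<lambda>c. \<integral>s. norm (case (c, s) of (c, s) \<Rightarrow> u c * c ^ 6 * pos s * pos (c - s)) \<partial>lborel)"
      using integrable_power[of 7] by (simp only: prod.case real_norm_def abs inner)
    show "AE c in lborel. integrable lborel (\<lambda>s. case (c, s) of (c, s) \<Rightarrow> u c * c ^ 6 * pos s * pos (c - s))"
    proof (rule AE_I2)
      fix c show "integrable lborel (\<lambda>s. case (c, s) of (c, s) \<Rightarrow> u c * c ^ 6 * pos s * pos (c - s))"
        unfolding prod.case eq by (cases "0 < c") (auto simp: u_zero)
    qed
  qed simp
  from lborel_pair.integral_fst'[OF this] show ?B by (simp only: prod.case inner)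
qed

lemma integrable_P3_bound:
  "integrable (lborel \<Otimes>\<^sub>M lborel) (\<lambda>(x, y). u (x + y) * (x + y) ^ 6 * pos x * pos y)"
  using integrable_unshear[where H = "\<lambda>x s. u s * s ^ 6 * pos x * pos (s - x)"]
    lborel_pair.integrable_product_swap[OF integrable_P3_sheared] by simp

lemma integrable_P3: "integrable (lborel \<Otimes>\<^sub>M lborel) (\<lambda>(x, y). P3 x y)"
  by (rule Bochner_Integration.integrable_bound[OF integrable_P3_bound])
    (auto intro!: AE_I2 simp: case_prod_beta' P_nonneg intro: order_trans[OF P3_le abs_ge_self])

text \<open>The quadratic and linear parts together, without the factor \<open>1 / r\<^sup>2\<close>, as integrals over the whole line.\<close>

definition collision :: "real \<Rightarrow> real" where
  "collision r = (\<integral>s. K s (r - s) * u s * u (r - s) \<partial>lborel)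
     + 2 * pos r * (\<integral>s. K r (s - r) * u s * u (s - r) \<partial>lborel)
     + 2 * u r * ((\<integral>s. K r (s - r) * u s * pos (s - r) \<partial>lborel)
                  - (\<integral>s. K s (r - s) * u s * pos (r - s) \<partial>lborel)
                  - (\<integral>s. K r s * u s \<partial>lborel))
     + 2 * pos r * (\<integral>s. K r (s - r) * u s * pos (s - r) \<partial>lborel)
     - u r * (\<integral>s. K s (r - s) * pos s * pos (r - s) \<partial>lborel)"

text \<open>Every term of the operator, at fixed r, is a slice of one of the three densities, so
  Fubini along the slices gives double integrals. For P1 and P3 the symmetry in x and y splits the
  doubled \<psi>(x) term into \<psi>(x) + \<psi>(y); for P2 the two summands come from different
  terms. What remains in each group is the increment \<Delta>.\<close>

lemma
  fixes \<psi> :: "real \<Rightarrow> real"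
  assumes [measurable]: "\<psi> \<in> borel_measurable borel"
    and \<psi>0: "\<And>r. r \<le> 0 \<Longrightarrow> \<psi> r = 0" and \<psi>C: "\<And>r. \<bar>\<psi> r\<bar> \<le> C"
  defines "\<Delta> \<equiv> \<lambda>x y. \<psi> (x + y) - \<psi> x - \<psi> y"
  shows integrable_collision: "integrable lborel (\<lambda>r. collision r * \<psi> r)" (is ?I)
    and integrable_P_\<Delta>:
      "integrable (lborel \<Otimes>\<^sub>M lborel) (\<lambda>(x, y). P1 x y * \<Delta> x y)" (is ?I1)
      "integrable (lborel \<Otimes>\<^sub>M lborel) (\<lambda>(x, y). P2 x y * \<Delta> x y)" (is ?I2)
      "integrable (lborel \<Otimes>\<^sub>M lborel) (\<lambda>(x, y). P3 x y * \<Delta> x y)" (is ?I3)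
    and collision_weak_form:
      "(\<integral>r. collision r * \<psi> r \<partial>lborel)
        = (\<integral>(x, y). P1 x y * \<Delta> x y \<partial>(lborel \<Otimes>\<^sub>M lborel))
          - 2 * (\<integral>(x, y). P2 x y * \<Delta> x y \<partial>(lborel \<Otimes>\<^sub>M lborel))
          - (\<integral>(x, y). P3 x y * \<Delta> x y \<partial>(lborel \<Otimes>\<^sub>M lborel))" (is ?W)
proof -
  let ?M = "lborel \<Otimes>\<^sub>M lborel :: (real \<times> real) measure"
  have tst: "integrable ?M (\<lambda>(x, y). P x y * \<psi> x)" "integrable ?M (\<lambda>(x, y). P x y * \<psi> y)"
    "integrable ?M (\<lambda>(x, y). P x y * \<psi> (x + y))" if P: "integrable ?M (\<lambda>(x, y). P x y)"
    for P :: "real \<Rightarrow> real \<Rightarrow> real"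
    using integrable_times_bounded[OF P, of "\<lambda>z. \<psi> (fst z)" C]
      integrable_times_bounded[OF P, of "\<lambda>z. \<psi> (snd z)" C]
      integrable_times_bounded[OF P, of "\<lambda>z. \<psi> (fst z + snd z)" C] \<psi>C
    by (simp_all add: case_prod_beta')
  have sw: "(\<integral>(x, y). F y x \<partial>?M) = (\<integral>(x, y). F x y \<partial>?M)" "integrable ?M (\<lambda>(x, y). F y x)"
    if "integrable ?M (\<lambda>(x, y). F x y)" for F :: "real \<Rightarrow> real \<Rightarrow> real"
    using lborel_pair.integral_product_swap[OF borel_measurable_integrable[OF that]]
      lborel_pair.integrable_product_swap[OF that] by simp_all
  note t1 = tst[OF integrable_P1] and t2 = tst[OF integrable_P2] and t3 = tst[OF integrable_P3]
  have \<Delta>: "(\<lambda>(x, y). P x y * \<Delta> x y)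
     = (\<lambda>z. (case z of (x, y) \<Rightarrow> P x y * \<psi> (x + y)) - (case z of (x, y) \<Rightarrow> P x y * \<psi> x) - (case z of (x, y) \<Rightarrow> P x y * \<psi> y))"
    for P by (auto simp: \<Delta>_def fun_eq_iff algebra_simps)
  show ?I1 ?I2 ?I3 unfolding \<Delta>
    by (intro Bochner_Integration.integrable_diff t1 t2 t3)+
  have D: "(\<integral>(x, y). P x y * \<Delta> x y \<partial>?M) = (\<integral>(x, y). P x y * \<psi> (x + y) \<partial>?M)
      - (\<integral>(x, y). P x y * \<psi> x \<partial>?M) - (\<integral>(x, y). P x y * \<psi> y \<partial>?M)"
    if P: "integrable ?M (\<lambda>(x, y). P x y)" for P
    unfolding \<Delta> using tst[OF P]
    by (simp only: Bochner_Integration.integral_diff Bochner_Integration.integrable_diff)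
  have row: "integrable lborel (\<lambda>r. \<integral>s. F r (s - r) \<partial>lborel)"
     "(\<integral>r. \<integral>s. F r (s - r) \<partial>lborel \<partial>lborel) = (\<integral>(x, y). F x y \<partial>?M)"
     "integrable lborel (\<lambda>r. \<integral>s. F s (r - s) \<partial>lborel)"
     "(\<integral>r. \<integral>s. F s (r - s) \<partial>lborel \<partial>lborel) = (\<integral>(x, y). F x y \<partial>?M)"
     "integrable lborel (\<lambda>r. \<integral>s. F r s \<partial>lborel)"
     "(\<integral>r. \<integral>s. F r s \<partial>lborel \<partial>lborel) = (\<integral>(x, y). F x y \<partial>?M)"
    if F: "integrable ?M (\<lambda>(x, y). F x y)" for F :: "real \<Rightarrow> real \<Rightarrow> real"
    using lborel_pair.integrable_fst[OF integrable_shear[OF F]] lborel_pair.integral_fst[OF integrable_shear[OF F]]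
      lborel_pair.integrable_snd[OF integrable_shear[OF F]] lborel_pair.integral_snd[OF integrable_shear[OF F]]
      lborel_pair.integrable_fst[OF F] lborel_pair.integral_fst[OF F] integral_shear[OF F] by simp_all
  \<comment> \<open>P2 is not symmetric: its slice y = r is treated as the slice x = r of the
    swapped density.\<close>
  have t2': "integrable ?M (\<lambda>(x, y). P2 y x * \<psi> x)" "(\<integral>(x, y). P2 y x * \<psi> x \<partial>?M) = (\<integral>(x, y). P2 x y * \<psi> y \<partial>?M)"
    using sw[OF t2(2)] by simp_all
  have s1: "(\<integral>(x, y). P1 x y * \<psi> y \<partial>?M) = (\<integral>(x, y). P1 x y * \<psi> x \<partial>?M)"
  proof -
    have "P1 x y = P1 y x" for x y by (simp add: P1_def K_def algebra_simps)
    then show ?thesis using sw(1)[OF t1(1)] by simp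
  qed
  have s3: "(\<integral>(x, y). P3 x y * \<psi> y \<partial>?M) = (\<integral>(x, y). P3 x y * \<psi> x \<partial>?M)"
  proof -
    have "P3 x y = P3 y x" for x y by (simp add: P3_def K_def algebra_simps)
    then show ?thesis using sw(1)[OF t3(1)] by simp
  qed
  \<comment> \<open>Arguments s and r - s describe the slice x + y = r and carry \<psi>(x + y); the
    other terms are slices with x = r or y = r. The trivial argument s + (r - s) is kept so that the
    integrands match the densities literally.\<close>
  have eq: "collision r * \<psi> r = (\<integral>s. P1 s (r - s) * \<psi> (s + (r - s)) \<partial>lborel)
      + 2 * (\<integral>s. P2 (s - r) r * \<psi> r \<partial>lborel)
      + 2 * (\<integral>s. P2 r (s - r) * \<psi> r \<partial>lborel)
      - 2 * (\<integral>s. P2 s (r - s) * \<psi> (s + (r - s)) \<partial>lborel)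
      - 2 * (\<integral>s. P1 r s * \<psi> r \<partial>lborel)
      + 2 * (\<integral>s. P3 r (s - r) * \<psi> r \<partial>lborel)
      - (\<integral>s. P3 s (r - s) * \<psi> (s + (r - s)) \<partial>lborel)" for r
  proof -
    have 1: "(\<integral>s. P1 s (r - s) * \<psi> (s + (r - s)) \<partial>lborel) = (\<integral>s. K s (r - s) * u s * u (r - s) \<partial>lborel) * \<psi> r"
      by (simp add: P1_def)
    have Kc: "K (s - r) r = K r (s - r)" for s by (simp add: K_def algebra_simps)
    have 2: "(\<integral>s. P2 (s - r) r * \<psi> r \<partial>lborel) = (\<integral>s. K r (s - r) * u s * u (s - r) \<partial>lborel) * pos r * \<psi> r"
      by (simp add: P2_def Kc)
    have 3: "(\<integral>s. P2 r (s - r) * \<psi> r \<partial>lborel) = (\<integral>s. K r (s - r) * u s * pos (s - r) \<partial>lborel) * (u r * \<psi> r)"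
      unfolding integral_mult_left_zero[symmetric] by (rule Bochner_Integration.integral_cong) (auto simp: P2_def algebra_simps)
    have 4: "(\<integral>s. P2 s (r - s) * \<psi> (s + (r - s)) \<partial>lborel) = (\<integral>s. K s (r - s) * u s * pos (r - s) \<partial>lborel) * (u r * \<psi> r)"
      unfolding integral_mult_left_zero[symmetric] by (rule Bochner_Integration.integral_cong) (auto simp: P2_def algebra_simps)
    have 5: "(\<integral>s. P1 r s * \<psi> r \<partial>lborel) = (\<integral>s. K r s * u s \<partial>lborel) * (u r * \<psi> r)"
      unfolding integral_mult_left_zero[symmetric] by (rule Bochner_Integration.integral_cong) (auto simp: P1_def algebra_simps)
    have 6: "(\<integral>s. P3 r (s - r) * \<psi> r \<partial>lborel) = (\<integral>s. K r (s - r) * u s * pos (s - r) \<partial>lborel) * (pos r * \<psi> r)"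
      unfolding integral_mult_left_zero[symmetric] by (rule Bochner_Integration.integral_cong) (auto simp: P3_def algebra_simps)
    have 7: "(\<integral>s. P3 s (r - s) * \<psi> (s + (r - s)) \<partial>lborel) = (\<integral>s. K s (r - s) * pos s * pos (r - s) \<partial>lborel) * (u r * \<psi> r)"
      unfolding integral_mult_left_zero[symmetric] by (rule Bochner_Integration.integral_cong) (auto simp: P3_def algebra_simps)
    show ?thesis unfolding 1 2 3 4 5 6 7 collision_def by (simp only: algebra_simps)
  qed
  note r1 = row[OF t1(3)] and r2 = row[OF t2'(1)] and r3 = row[OF t2(1)] and r4 = row[OF t2(3)]
    and r5 = row[OF t1(1)] and r6 = row[OF t3(1)] and r7 = row[OF t3(3)]
  show ?I unfolding eq
    by (intro Bochner_Integration.integrable_add Bochner_Integration.integrable_diff integrable_mult_right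
        r1(3) r2(1) r3(1) r4(3) r5(5) r6(1) r7(3))
  have "(\<integral>r. collision r * \<psi> r \<partial>lborel) = (\<integral>(x, y). P1 x y * \<psi> (x + y) \<partial>?M)
      + 2 * (\<integral>(x, y). P2 x y * \<psi> y \<partial>?M) + 2 * (\<integral>(x, y). P2 x y * \<psi> x \<partial>?M)
      - 2 * (\<integral>(x, y). P2 x y * \<psi> (x + y) \<partial>?M) - 2 * (\<integral>(x, y). P1 x y * \<psi> x \<partial>?M)
      + 2 * (\<integral>(x, y). P3 x y * \<psi> x \<partial>?M) - (\<integral>(x, y). P3 x y * \<psi> (x + y) \<partial>?M)"
    unfolding eq
    apply (subst Bochner_Integration.integral_diff Bochner_Integration.integral_add,
      (intro Bochner_Integration.integrable_add Bochner_Integration.integrable_diff integrable_mult_right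
        r1(3) r2(1) r3(1) r4(3) r5(5) r6(1) r7(3))+)+
    unfolding integral_mult_right_zero r1(4) r2(2) r3(2) r4(4) r5(6) r6(2) r7(4) t2'(2)
    by simp
  then show ?W
    unfolding D[OF integrable_P1] D[OF integrable_P2] D[OF integrable_P3] s1 s3 by simp
qed

end

section \<open>Gain and loss of truncated exponential moments\<close>

context profile
begin

lemma integral_P2_le:
  "(\<integral>(x, y). P2 x y \<partial>(lborel \<Otimes>\<^sub>M lborel)) \<le> (\<integral>r. u r * r ^ 2 \<partial>lborel) * (\<integral>r. u r * r ^ 4 \<partial>lborel)"
proof -
  have "(\<integral>(x, y). P2 x y \<partial>(lborel \<Otimes>\<^sub>M lborel))
      \<le> (\<integral>(x, y). (u x * x ^ 2) * (u (x + y) * (x + y) ^ 4) \<partial>(lborel \<Otimes>\<^sub>M lborel))"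
    by (rule integral_mono[OF integrable_P2 integrable_P2_bound]) (auto intro: P2_le)
  also have "\<dots> = (\<integral>(x, s). (u x * x ^ 2) * (u s * s ^ 4) \<partial>(lborel \<Otimes>\<^sub>M lborel))"
    using integral_shear[OF integrable_P2_bound] by simp
  also have "\<dots> = (\<integral>r. u r * r ^ 2 \<partial>lborel) * (\<integral>r. u r * r ^ 4 \<partial>lborel)"
    by (rule integral_times_lborel) (auto intro!: integrable_power)
  finally show ?thesis .
qed

lemma integral_P3_le:
  "(\<integral>(x, y). P3 x y \<partial>(lborel \<Otimes>\<^sub>M lborel)) \<le> (\<integral>r. u r * r ^ 7 \<partial>lborel)"
proof -
  have "(\<integral>(x, y). P3 x y \<partial>(lborel \<Otimes>\<^sub>M lborel))
      \<le> (\<integral>(x, y). u (x + y) * (x + y) ^ 6 * pos x * pos y \<partial>(lborel \<Otimes>\<^sub>M lborel))"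
    by (rule integral_mono[OF integrable_P3 integrable_P3_bound]) (auto intro: P3_le)
  also have "\<dots> = (\<integral>(x, s). u s * s ^ 6 * pos x * pos (s - x) \<partial>(lborel \<Otimes>\<^sub>M lborel))"
    using integral_shear[OF integrable_P3_bound] by simp
  also have "\<dots> = (\<integral>r. u r * r ^ 7 \<partial>lborel)"
    using lborel_pair.integral_product_swap[OF borel_measurable_integrable[OF integrable_P3_sheared]]
      integral_P3_sheared by simp
  finally show ?thesis .
qed

text \<open>Tested with 1 on the positive axis, \<Delta> equals -1, so the signs reverse: the P1
  term is nonpositive and dropped, the other two are bounded by moments. An upper bound on this mass
  flux limits how fast \<open>nc\<close> can fall.\<close>

lemma integral_collision_le:
  "(\<integral>r. collision r * pos r \<partial>lborel)
     \<le> 2 * ((\<integral>r. u r * r ^ 2 \<partial>lborel) * (\<integral>r. u r * r ^ 4 \<partial>lborel)) + (\<integral>r. u r * r ^ 7 \<partial>lborel)"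
proof -
  have eq: "P1 x y * (pos (x + y) - pos x - pos y) = - P1 x y"
     "P2 x y * (pos (x + y) - pos x - pos y) = - P2 x y"
     "P3 x y * (pos (x + y) - pos x - pos y) = - P3 x y" for x y
    by (cases "0 < x \<and> 0 < y"; auto simp: P1_def P2_def P3_def u_zero not_less)+
  have "(\<integral>r. collision r * pos r \<partial>lborel) = - (\<integral>(x, y). P1 x y \<partial>(lborel \<Otimes>\<^sub>M lborel))
      + 2 * (\<integral>(x, y). P2 x y \<partial>(lborel \<Otimes>\<^sub>M lborel)) + (\<integral>(x, y). P3 x y \<partial>(lborel \<Otimes>\<^sub>M lborel))"
  proof -
    have "pos \<in> borel_measurable borel" "\<And>r. r \<le> 0 \<Longrightarrow> pos r = 0" "\<And>r. \<bar>pos r\<bar> \<le> 1"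
      by (auto simp: indicator_def)
    from collision_weak_form[OF this] show ?thesis
      unfolding eq by (simp add: case_prod_beta')
  qed
  moreover have "0 \<le> (\<integral>(x, y). P1 x y \<partial>(lborel \<Otimes>\<^sub>M lborel))"
    by (rule Bochner_Integration.integral_nonneg) (auto simp: P_nonneg)
  ultimately show ?thesis using integral_P2_le integral_P3_le by linarith
qed

end

section \<open>Truncated exponential weights and the bounded test function\<close>

definition gexp :: "real \<Rightarrow> real \<Rightarrow> real \<Rightarrow> real" where
  "gexp \<theta> N r = exp (\<theta> * min r N)"

lemma gexp_pos: "0 < gexp \<theta> N r" by (simp add: gexp_def)

lemma gexp_mono: "0 \<le> \<theta> \<Longrightarrow> r \<le> s \<Longrightarrow> gexp \<theta> N r \<le> gexp \<theta> N s"
  by (auto simp: gexp_def intro!: mult_left_mono)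

lemma gexp_le: "0 \<le> \<theta> \<Longrightarrow> gexp \<theta> N r \<le> exp (\<theta> * N)"
  by (auto simp: gexp_def intro!: mult_left_mono)

lemma gexp_measurable [measurable]:
  "f \<in> borel_measurable M \<Longrightarrow> (\<lambda>x. gexp \<theta> N (f x)) \<in> borel_measurable M"
  unfolding gexp_def by measurable

text \<open>\<open>min r N\<close> is subadditive in r, hence the weight is submultiplicative; the
  rest is exp z - 1 <= z exp z.\<close>

lemma gexp_add_le:
  assumes "0 \<le> \<theta>" "0 < N" "0 < x" "0 < y"
  shows "gexp \<theta> N (x + y) - gexp \<theta> N x \<le> gexp \<theta> N x * (\<theta> * min y N * gexp \<theta> N y)"
proof -
  have "\<theta> * min (x + y) N \<le> \<theta> * min x N + \<theta> * min y N"
    unfolding distrib_left[symmetric] using assms by (intro mult_left_mono) auto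
  then have 1: "gexp \<theta> N (x + y) \<le> gexp \<theta> N x * gexp \<theta> N y"
    unfolding gexp_def exp_add[symmetric] by simp
  have 2: "exp z - 1 \<le> z * exp z" for z :: real
    using exp_ge_add_one_self[of "- z"] mult_right_mono[of "1 - z" "exp (- z)" "exp z"]
    by (simp add: exp_minus algebra_simps)
  have "gexp \<theta> N (x + y) - gexp \<theta> N x \<le> gexp \<theta> N x * (gexp \<theta> N y - 1)"
    using 1 by (simp add: algebra_simps)
  also have "\<dots> \<le> gexp \<theta> N x * (\<theta> * min y N * gexp \<theta> N y)"
    using 2[of "\<theta> * min y N"] gexp_pos[of \<theta> N x] by (intro mult_left_mono) (auto simp: gexp_def)
  finally show ?thesis .
qed

text \<open>Expanding (x + y)^2 produces x^5, but only one factor \<open>min x N\<close> is allowed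
  beyond x^4. This costs nothing for x < N, where the minimum is x, and for x >= N the weight no
  longer increases and the left side is zero.\<close>

lemma gain_bound_half:
  assumes "0 \<le> \<theta>" "0 < N" "0 < x" "0 < y"
  shows "K x y * (x * (gexp \<theta> N (x + y) - gexp \<theta> N x))
    \<le> 2 * \<theta> * (x ^ 4 * min x N * gexp \<theta> N x * (y ^ 3 * gexp \<theta> N y)
               + x ^ 3 * gexp \<theta> N x * (y ^ 4 * min y N * gexp \<theta> N y))"
proof (cases "N \<le> x")
  case True
  then have "gexp \<theta> N (x + y) = gexp \<theta> N x" using assms by (simp add: gexp_def)
  then show ?thesis using assms
    by (auto intro!: mult_nonneg_nonneg add_nonneg_nonneg less_imp_le[OF gexp_pos])
next
  case False
  have "K x y * (x * (gexp \<theta> N (x + y) - gexp \<theta> N x))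
      \<le> K x y * (x * (gexp \<theta> N x * (\<theta> * min y N * gexp \<theta> N y)))"
    using gexp_add_le[OF assms] assms by (intro mult_left_mono) (auto simp: K_def)
  also have "\<dots> = \<theta> * gexp \<theta> N x * gexp \<theta> N y * (x ^ 3 * y\<^sup>2 * min y N * (x + y)\<^sup>2)"
    by (simp add: K_def power_numeral_reduce algebra_simps)
  also have "\<dots> \<le> \<theta> * gexp \<theta> N x * gexp \<theta> N y * (2 * (x ^ 4 * x * y ^ 3 + x ^ 3 * (y ^ 4 * min y N)))"
  proof (rule mult_left_mono)
    have "x ^ 3 * y\<^sup>2 * min y N * (x + y)\<^sup>2 \<le> x ^ 3 * y\<^sup>2 * min y N * (2 * x\<^sup>2 + 2 * y\<^sup>2)"
      using zero_le_power2[of "x - y"] assms by (intro mult_left_mono) (auto simp: power2_eq_square algebra_simps)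
    also have "\<dots> = 2 * (x ^ 5 * y\<^sup>2 * min y N + x ^ 3 * (y ^ 4 * min y N))"
      by (simp add: power_numeral_reduce algebra_simps)
    also have "x ^ 5 * y\<^sup>2 * min y N \<le> x ^ 5 * y\<^sup>2 * y"
      using assms by (intro mult_left_mono) auto
    also have "x ^ 5 * y\<^sup>2 * y = x ^ 4 * x * y ^ 3"
      by (simp add: power_numeral_reduce algebra_simps)
    finally show "x ^ 3 * y\<^sup>2 * min y N * (x + y)\<^sup>2 \<le> 2 * (x ^ 4 * x * y ^ 3 + x ^ 3 * (y ^ 4 * min y N))"
      by simp
  qed (use assms in \<open>simp add: less_imp_le[OF gexp_pos]\<close>)
  also have "\<dots> = 2 * \<theta> * (x ^ 4 * min x N * gexp \<theta> N x * (y ^ 3 * gexp \<theta> N y)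
               + x ^ 3 * gexp \<theta> N x * (y ^ 4 * min y N * gexp \<theta> N y))"
    using False by (simp add: algebra_simps)
  finally show ?thesis .
qed

text \<open>The gap vanishes at z = 0, so it controls exp z only up to a constant. The offset 3
  makes the left side nonpositive for z <= 1, since e <= 3; for z > 1, exp(z/2) >= 3/2 makes
  exp(z/2) at most 2/3 of exp z.\<close>

lemma exp_half_gap:
  fixes z :: real
  assumes "0 \<le> z"
  shows "(exp z - 3) / 3 \<le> exp z - exp (z / 2)"
proof (cases "z \<le> 1")
  case True
  then have "exp z \<le> 3" using exp_le order_trans[of "exp z" "exp 1" 3] by simp
  then have "(exp z - 3) / 3 \<le> 0" by simp
  also have "0 \<le> exp z - exp (z / 2)" using assms by simp
  finally show ?thesis .
next
  case False
  have "3 / 2 \<le> exp (z / 2)" using exp_ge_add_one_self[of "z / 2"] False by linarith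
  then have "3 / 2 * exp (z / 2) \<le> exp (z / 2) * exp (z / 2)" by (intro mult_right_mono) auto
  also have "\<dots> = exp z" by (simp flip: exp_add)
  finally show ?thesis by simp
qed

text \<open>From r = N on the weight has reached its cap and the function is zero. The subtracted
  multiple of r is additive and drops out of \<Delta>.\<close>

definition cut_test :: "real \<Rightarrow> real \<Rightarrow> real \<Rightarrow> real" where
  "cut_test \<theta> N r = pos r * r * (gexp \<theta> N r - exp (\<theta> * N))"

lemma cut_test_bound:
  assumes "0 \<le> \<theta>" "0 < N"
  shows "\<bar>cut_test \<theta> N r\<bar> \<le> N * exp (\<theta> * N)"
proof (cases "0 < r \<and> r < N")
  case True
  then have "\<bar>gexp \<theta> N r - exp (\<theta> * N)\<bar> \<le> exp (\<theta> * N)"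
    using gexp_le[OF assms(1), of N r] gexp_pos[of \<theta> N r] by (simp add: abs_if)
  then have "r * \<bar>gexp \<theta> N r - exp (\<theta> * N)\<bar> \<le> N * exp (\<theta> * N)"
    using True by (intro mult_mono) auto
  then show ?thesis using True by (simp add: cut_test_def abs_mult)
next
  case False
  then have "cut_test \<theta> N r = 0" by (auto simp: cut_test_def gexp_def)
  then show ?thesis using assms by simp
qed

lemma cut_test_measurable [measurable]: "cut_test \<theta> N \<in> borel_measurable borel"
  unfolding cut_test_def by measurable

section \<open>Exponential moments: interpolation, gain and loss\<close>

context profile
begin

lemma integrable_gexp:
  assumes "0 \<le> \<theta>" "0 < N" "2 \<le> k" "k \<le> 8"
  shows "integrable lborel (\<lambda>r. u r * (r ^ k * gexp \<theta> N r))"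
proof (rule integrable_weight[where C = "exp (\<theta> * N)"])
  fix r :: real assume "0 < r"
  then show "\<bar>r ^ k * gexp \<theta> N r\<bar> \<le> exp (\<theta> * N) * (r ^ 2 + r ^ 8)"
    using mult_mono[OF power_between[of r k] gexp_le[of \<theta> N r]] assms gexp_pos[of \<theta> N r]
    by (simp add: mult.commute)
qed simp

lemma integrable_gexp_min:
  assumes "0 \<le> \<theta>" "0 < N" "2 \<le> k" "k + l \<le> 8"
  shows "integrable lborel (\<lambda>r. u r * (r ^ k * (min r N) ^ l * gexp \<theta> N r))"
proof (rule integrable_weight[where C = "exp (\<theta> * N)"])
  fix r :: real assume r: "0 < r"
  then have "r ^ k * (min r N) ^ l \<le> r ^ k * r ^ l"
    using assms by (intro mult_left_mono power_mono) auto
  also have "\<dots> \<le> r ^ 2 + r ^ 8" using power_between[of r "k + l"] r assms by (simp add: power_add)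
  finally have "r ^ k * (min r N) ^ l * gexp \<theta> N r \<le> (r ^ 2 + r ^ 8) * exp (\<theta> * N)"
    using gexp_le[of \<theta> N r] gexp_pos[of \<theta> N r] assms by (intro mult_mono) auto
  then show "\<bar>r ^ k * (min r N) ^ l * gexp \<theta> N r\<bar> \<le> exp (\<theta> * N) * (r ^ 2 + r ^ 8)"
    using r assms gexp_pos[of \<theta> N r] by (simp add: mult.commute)
qed simp

text \<open>Beyond the cut-off the loss only grows like \<open>r ^ 4\<close>, so the truncation \<open>min r N\<close> has to enter the
  polynomial weights as well.\<close>

definition E3 :: "real \<Rightarrow> real \<Rightarrow> real" where
  "E3 \<theta> N = (\<integral>r. u r * (r ^ 3 * gexp \<theta> N r) \<partial>lborel)"
definition E4 :: "real \<Rightarrow> real \<Rightarrow> real" where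
  "E4 \<theta> N = (\<integral>r. u r * (r ^ 3 * min r N * gexp \<theta> N r) \<partial>lborel)"
definition E5 :: "real \<Rightarrow> real \<Rightarrow> real" where
  "E5 \<theta> N = (\<integral>r. u r * (r ^ 4 * min r N * gexp \<theta> N r) \<partial>lborel)"
definition E8 :: "real \<Rightarrow> real \<Rightarrow> real" where
  "E8 \<theta> N = (\<integral>r. u r * (r ^ 4 * (min r N) ^ 4 * gexp \<theta> N r) \<partial>lborel)"

lemma E_integrable:
  assumes "0 \<le> \<theta>" "0 < N"
  shows "integrable lborel (\<lambda>r. u r * (r ^ 3 * gexp \<theta> N r))"
    "integrable lborel (\<lambda>r. u r * (r ^ 3 * min r N * gexp \<theta> N r))"
    "integrable lborel (\<lambda>r. u r * (r ^ 4 * min r N * gexp \<theta> N r))"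
    "integrable lborel (\<lambda>r. u r * (r ^ 4 * (min r N) ^ 4 * gexp \<theta> N r))"
  using integrable_gexp[OF assms, of 3] integrable_gexp_min[OF assms, of 3 1]
    integrable_gexp_min[OF assms, of 4 1] integrable_gexp_min[OF assms, of 4 4] by simp_all

lemma weighted_mono:
  assumes h: "integrable lborel (\<lambda>r. u r * h r)"
    and k: "integrable lborel (\<lambda>r. u r * k r)" "integrable lborel (\<lambda>r. u r * l r)"
    and le: "\<And>r. 0 < r \<Longrightarrow> a * h r \<le> b * k r + c * l r"
  shows "a * (\<integral>r. u r * h r \<partial>lborel) \<le> b * (\<integral>r. u r * k r \<partial>lborel) + c * (\<integral>r. u r * l r \<partial>lborel)"
proof -
  have "(\<integral>r. a * (u r * h r) \<partial>lborel) \<le> (\<integral>r. b * (u r * k r) + c * (u r * l r) \<partial>lborel)"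
  proof (rule integral_mono)
    fix r show "a * (u r * h r) \<le> b * (u r * k r) + c * (u r * l r)"
      using mult_left_mono[OF le, of r "u r"] u_nonneg[of r] u_zero[of r]
      by (cases "0 < r") (auto simp: algebra_simps)
  qed (use h k in auto)
  then show ?thesis using h k by simp
qed

text \<open>Splits the factor E5 of the gain into a part governed by the barrier level and a part to
  be absorbed by the loss. Below r = 1 the third power dominates, above it the fourth power of
  \<open>min r N\<close>.\<close>

lemma E5_le: 
  assumes "0 \<le> \<theta>" "1 \<le> N"
  shows "E5 \<theta> N \<le> E3 \<theta> N + E8 \<theta> N"
proof -
  note I = E_integrable[OF assms(1), of N]
  have "1 * E5 \<theta> N \<le> 1 * E3 \<theta> N + 1 * E8 \<theta> N"
    unfolding E5_def E3_def E8_def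
  proof (rule weighted_mono)
    fix r :: real assume r: "0 < r"
    have "r ^ 4 * min r N \<le> r ^ 3 + r ^ 4 * (min r N) ^ 4"
    proof (cases "1 \<le> r")
      case True
      then have "min r N \<le> (min r N) ^ 4" using assms by (intro self_le_power) auto
      then show ?thesis using r by (intro add_increasing mult_left_mono) auto
    next
      case False
      then have "r ^ 4 * min r N \<le> r ^ 4" "r ^ 4 \<le> r ^ 3" 
        using r assms by (auto intro!: power_decreasing simp: mult_le_cancel_left1)
      moreover have "0 \<le> r ^ 4 * (min r N) ^ 4" by simp
      ultimately show ?thesis by linarith
    qed
    then show "1 * (r ^ 4 * min r N * gexp \<theta> N r) \<le> 1 * (r ^ 3 * gexp \<theta> N r) + 1 * (r ^ 4 * (min r N) ^ 4 * gexp \<theta> N r)"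
      unfolding mult_1_left distrib_right[symmetric] using gexp_pos[of \<theta> N r] by (intro mult_right_mono) auto
  qed (use I assms in auto)
  then show ?thesis by simp
qed

lemma gexp_le_3: "0 \<le> \<theta> \<Longrightarrow> \<theta> * min r N \<le> 1 \<Longrightarrow> gexp \<theta> N r \<le> 3"
  using exp_le order_trans[of "exp (\<theta> * min r N)" "exp 1" 3] by (simp add: gexp_def)

text \<open>Read backwards, this is coercivity: a large E3 forces a large E8. Only r < 1 needs the
  additional third moment, and there \<theta> <= 1 keeps the exponential below 3.\<close>

lemma E3_le:
  assumes "0 \<le> \<theta>" "\<theta> \<le> 1" "1 \<le> N"
  shows "E3 \<theta> N \<le> E8 \<theta> N + 3 * (\<integral>r. u r * r ^ 3 \<partial>lborel)"
proof -
  note I = E_integrable[OF assms(1), of N] integrable_power[of 3]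
  have "1 * E3 \<theta> N \<le> 1 * E8 \<theta> N + 3 * (\<integral>r. u r * r ^ 3 \<partial>lborel)"
    unfolding E3_def E8_def
  proof (rule weighted_mono)
    fix r :: real assume r: "0 < r"
    show "1 * (r ^ 3 * gexp \<theta> N r) \<le> 1 * (r ^ 4 * (min r N) ^ 4 * gexp \<theta> N r) + 3 * r ^ 3"
    proof (cases "1 \<le> r")
      case True
      then have "r ^ 3 * 1 \<le> r ^ 4 * (min r N) ^ 4"
        using assms by (intro mult_mono power_increasing one_le_power) auto
      then have "r ^ 3 * gexp \<theta> N r \<le> r ^ 4 * (min r N) ^ 4 * gexp \<theta> N r"
        using gexp_pos[of \<theta> N r] by (intro mult_right_mono) auto
      then show ?thesis using r by (auto intro: add_increasing2)
    next
      case False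
      then have "\<theta> * min r N \<le> 1 * 1" using r assms by (intro mult_mono) auto
      then have "r ^ 3 * gexp \<theta> N r \<le> r ^ 3 * 3"
        using gexp_le_3[of \<theta> r N] assms r by (intro mult_left_mono) auto
      then show ?thesis using gexp_pos[of \<theta> N r] by (intro add_increasing) auto
    qed
  qed (use I assms in auto)
  then show ?thesis by simp
qed

text \<open>Absorbs the time derivative of the exponent: where \<open>r * (min r N) ^ 3\<close> is too small for the loss to
  dominate, the exponential weight is bounded because \<open>\<theta> * min r N \<le> 1\<close>.\<close>

lemma E4_le:
  assumes "0 \<le> \<theta>" "1 \<le> N" "0 \<le> \<mu>" "0 \<le> \<beta>" "\<mu> * \<theta> ^ 4 \<le> \<beta>"
  shows "\<mu> * E4 \<theta> N \<le> \<beta> * E8 \<theta> N + 3 * \<mu> * (\<integral>r. u r * r ^ 4 \<partial>lborel)"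
proof -
  note I = E_integrable[OF assms(1), of N] integrable_power[of 4]
  show ?thesis unfolding E4_def E8_def
  proof (rule weighted_mono)
    fix r :: real assume r: "0 < r"
    define m where "m = min r N"
    have m: "0 < m" "m \<le> r" using r assms by (auto simp: m_def)
    show "\<mu> * (r ^ 3 * min r N * gexp \<theta> N r)
       \<le> \<beta> * (r ^ 4 * (min r N) ^ 4 * gexp \<theta> N r) + 3 * \<mu> * r ^ 4"
    proof (cases "\<mu> \<le> \<beta> * (r * m ^ 3)")
      case True
      then have "\<mu> * (r ^ 3 * m * gexp \<theta> N r) \<le> \<beta> * (r * m ^ 3) * (r ^ 3 * m * gexp \<theta> N r)"
        using gexp_pos[of \<theta> N r] r m by (intro mult_right_mono) auto
      also have "\<dots> = \<beta> * (r ^ 4 * m ^ 4 * gexp \<theta> N r)"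
        by (simp add: power_numeral_reduce algebra_simps)
      finally show ?thesis using assms unfolding m_def by (intro add_increasing2) auto
    next
      case False
      then have \<mu>: "0 < \<mu>" using assms(4) r m
        by (meson assms(3) less_eq_real_def mult_nonneg_nonneg not_less order_trans zero_le_power)
      have "\<mu> * (\<theta> * m) ^ 4 = (\<mu> * \<theta> ^ 4) * m ^ 4" by (simp add: power_mult_distrib)
      also have "\<dots> \<le> \<beta> * (m * m ^ 3)"
        using mult_right_mono[OF assms(5), of "m ^ 4"] by (simp add: power_Suc[symmetric])
      also have "\<dots> \<le> \<beta> * (r * m ^ 3)" using m assms by (intro mult_left_mono mult_right_mono) auto
      also have "\<dots> \<le> \<mu> * 1" using False by simp
      finally have "(\<theta> * m) ^ 4 \<le> 1 ^ 4" using \<mu> by (simp only: mult_le_cancel_left_pos) simp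
      then have "\<theta> * m \<le> 1" by (rule power_le_imp_le_base[of _ 3, unfolded numeral_eq_Suc, simplified]) simp
      then have "gexp \<theta> N r \<le> 3" using gexp_le_3[of \<theta> r N] assms unfolding m_def by simp
      then have "r ^ 3 * m * gexp \<theta> N r \<le> r ^ 3 * r * 3"
        using r m gexp_pos[of \<theta> N r] by (intro mult_mono) auto
      then have "\<mu> * (r ^ 3 * m * gexp \<theta> N r) \<le> \<mu> * (r ^ 3 * r * 3)"
        using \<mu> by (intro mult_left_mono) auto
      also have "\<dots> = 3 * \<mu> * r ^ 4" by (simp add: power_numeral_reduce algebra_simps)
      finally show ?thesis using assms r m gexp_pos[of \<theta> N r] unfolding m_def
        by (intro add_increasing) (auto intro!: mult_nonneg_nonneg)
    qed
  qed (use I assms in auto)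
qed

text \<open>The cubic term is dropped by its sign. The loss is kept only for s between m/4 and m/2,
  with m = \<open>min r N\<close>: the kernel is at least (m/4)^2 (r/2)^2 r^2, the increment at
  least m/4 times the exponential gap, and the interval has length m/4. Together this is r^4 m^4 /
  1024 times the gap, and the third lost in \<open>exp_half_gap\<close> gives 3072. The offset there
  produces the subtracted eighth moment, as m <= r.\<close>

lemma collision_cut_test_le:
  assumes \<theta>: "0 \<le> \<theta>" and N: "0 < N"
  shows "(\<integral>r. collision r * cut_test \<theta> N r \<partial>lborel)
     \<le> 8 * \<theta> * E3 \<theta> N * E5 \<theta> N - (E8 \<theta> N - 3 * (\<integral>r. u r * r ^ 8 \<partial>lborel)) / 3072"
proof -
  let ?M = "lborel \<Otimes>\<^sub>M lborel :: (real \<times> real) measure"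
  let ?g = "gexp \<theta> N"
  define \<psi> where "\<psi> = cut_test \<theta> N"
  define \<Delta> where "\<Delta> x y = \<psi> (x + y) - \<psi> x - \<psi> y" for x y
  have \<psi>: "\<psi> \<in> borel_measurable borel" "\<And>r. r \<le> 0 \<Longrightarrow> \<psi> r = 0" "\<And>r. \<bar>\<psi> r\<bar> \<le> N * exp (\<theta> * N)"
    using cut_test_bound[OF assms] by (auto simp: \<psi>_def cut_test_def)
  note W = collision_weak_form[OF \<psi>] and I = integrable_P_\<Delta>[OF \<psi>]
  have \<Delta>_eq: "\<Delta> x y = x * (?g (x + y) - ?g x) + y * (?g (x + y) - ?g y)" if "0 < x" "0 < y" for x y
    using that by (simp add: \<Delta>_def \<psi>_def cut_test_def algebra_simps)
  have \<Delta>_nonneg: "0 \<le> \<Delta> x y" if "0 < x" "0 < y" for x y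
    unfolding \<Delta>_eq[OF that] using that by (auto intro!: add_nonneg_nonneg mult_nonneg_nonneg gexp_mono \<theta>)
  define a3 where "a3 r = u r * (r ^ 3 * ?g r)" for r
  define a5 where "a5 r = u r * (r ^ 4 * min r N * ?g r)" for r
  note E_int = E_integrable[OF assms]
  have a: "integrable lborel a3" "integrable lborel a5" using E_int unfolding a3_def a5_def by auto

  \<comment> \<open>\<Delta> consists of two halves, each bounded with the factor 2 \<theta> by the
    same symmetric sum; the two products in that sum have equal integrals, so the total factor is 8
    \<theta>.\<close>
  have "(\<integral>(x, y). P1 x y * \<Delta> x y \<partial>?M)
     \<le> (\<integral>z. 4 * \<theta> * ((case z of (x, y) \<Rightarrow> a5 x * a3 y) + (case z of (x, y) \<Rightarrow> a3 x * a5 y)) \<partial>?M)"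
  proof (rule integral_mono)
    show "integrable ?M (\<lambda>z. 4 * \<theta> * ((case z of (x, y) \<Rightarrow> a5 x * a3 y) + (case z of (x, y) \<Rightarrow> a3 x * a5 y)))"
      by (intro integrable_mult_right Bochner_Integration.integrable_add integrable_times_lborel a)
    fix z :: "real \<times> real"
    obtain x y where z: "z = (x, y)" by force
    have "P1 x y * \<Delta> x y \<le> 4 * \<theta> * (a5 x * a3 y + a3 x * a5 y)"
    proof (cases "0 < x \<and> 0 < y")
      case True
      have Kc: "K y x = K x y" by (simp add: K_def algebra_simps)
      have "K x y * \<Delta> x y \<le> 4 * \<theta> * (x ^ 4 * min x N * ?g x * (y ^ 3 * ?g y)
               + x ^ 3 * ?g x * (y ^ 4 * min y N * ?g y))"
        using gain_bound_half[OF \<theta> N, of x y] gain_bound_half[OF \<theta> N, of y x] True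
        unfolding Kc \<Delta>_eq[OF conjunct1[OF True] conjunct2[OF True]]
        by (simp add: algebra_simps)
      then have "(K x y * \<Delta> x y) * (u x * u y) \<le> 4 * \<theta> * (x ^ 4 * min x N * ?g x * (y ^ 3 * ?g y)
               + x ^ 3 * ?g x * (y ^ 4 * min y N * ?g y)) * (u x * u y)"
        by (rule mult_right_mono) (simp add: u_nonneg)
      then show ?thesis by (simp add: P1_def a3_def a5_def algebra_simps)
    qed (auto simp: P1_def a3_def a5_def u_zero not_less)
    then show "(case z of (x, y) \<Rightarrow> P1 x y * \<Delta> x y) \<le> 4 * \<theta> * ((case z of (x, y) \<Rightarrow> a5 x * a3 y) + (case z of (x, y) \<Rightarrow> a3 x * a5 y))"
      by (simp add: z)
  qed (use I(1) in \<open>simp add: \<Delta>_def\<close>)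
  also have "\<dots> = 8 * \<theta> * integral\<^sup>L lborel a3 * integral\<^sup>L lborel a5"
    using integrable_times_lborel[OF a(2,1)] integrable_times_lborel[OF a(1,2)]
      integral_times_lborel[OF a(2,1)] integral_times_lborel[OF a(1,2)] by simp
  also have "\<dots> = 8 * \<theta> * E3 \<theta> N * E5 \<theta> N" by (simp add: E3_def E5_def a3_def[abs_def] a5_def[abs_def])
  finally have gain: "(\<integral>(x, y). P1 x y * \<Delta> x y \<partial>?M) \<le> 8 * \<theta> * E3 \<theta> N * E5 \<theta> N" .

  have P\<Delta>_nonneg: "0 \<le> P2 x y * \<Delta> x y" "0 \<le> P3 x y * \<Delta> x y" for x y
  proof -
    show "0 \<le> P2 x y * \<Delta> x y"
      using P_nonneg[of x y] \<Delta>_nonneg[of x y] u_zero[of x] by (cases "0 < x \<and> 0 < y") (auto simp: P2_def not_less)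
    show "0 \<le> P3 x y * \<Delta> x y"
      using P_nonneg[of x y] \<Delta>_nonneg[of x y] by (cases "0 < x \<and> 0 < y") (auto simp: P3_def not_less)
  qed
  have cubic: "0 \<le> (\<integral>(x, y). P2 x y * \<Delta> x y \<partial>?M)"
    by (rule Bochner_Integration.integral_nonneg) (auto simp: P\<Delta>_nonneg)

  have I3: "integrable ?M (\<lambda>(s, r). P3 s (r - s) * \<Delta> s (r - s))"
    using integrable_shear[of "\<lambda>x y. P3 x y * \<Delta> x y"] I(3) by (simp add: \<Delta>_def)
  have "(E8 \<theta> N - 3 * (\<integral>r. u r * r ^ 8 \<partial>lborel)) / 3072
      = (\<integral>r. (u r * (r ^ 4 * (min r N) ^ 4 * ?g r) - 3 * (u r * r ^ 8)) / 3072 \<partial>lborel)"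
    using E_int u_integrable8 by (simp add: E8_def)
  also have "\<dots> \<le> (\<integral>r. \<integral>s. P3 s (r - s) * \<Delta> s (r - s) \<partial>lborel \<partial>lborel)"
  proof (rule integral_mono_AE)
    show "integrable lborel (\<lambda>r. \<integral>s. P3 s (r - s) * \<Delta> s (r - s) \<partial>lborel)"
      by (rule lborel_pair.integrable_snd[OF I3])
    show "AE r in lborel. (u r * (r ^ 4 * (min r N) ^ 4 * ?g r) - 3 * (u r * r ^ 8)) / 3072
        \<le> (\<integral>s. P3 s (r - s) * \<Delta> s (r - s) \<partial>lborel)"
      \<comment> \<open>The comparison inside a slice needs the slice to be integrable, which Fubini
        grants for almost every r only.\<close>
      using lborel_pair.AE_integrable_snd[OF I3]
    proof eventually_elim
      case (elim r)
      show ?case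
      proof (cases "0 < r")
        case True
        define m where "m = min r N"
        have m: "0 < m" "m \<le> r" using True N by (auto simp: m_def)
        \<comment> \<open>A lower bound for the loss density that is constant in s on the interval
          from m/4 to m/2, where s <= m/2 keeps r - s >= r/2.\<close>
        define c where "c = u r * ((m / 4)\<^sup>2 * (r / 2)\<^sup>2 * r\<^sup>2 * (m / 4 * (exp (\<theta> * m) - exp (\<theta> * m / 2))))"
        have gr: "?g r = exp (\<theta> * m)" by (simp add: gexp_def m_def)
        have "u r * (r ^ 4 * m ^ 4 * ?g r) - 3 * (u r * r ^ 8)
            = u r * (r ^ 4 * (m ^ 4 * ?g r - 3 * r ^ 4))"
          by (simp add: power_numeral_reduce algebra_simps)
        also have "\<dots> \<le> u r * (r ^ 4 * (m ^ 4 * ?g r - 3 * m ^ 4))"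
          using m by (intro mult_left_mono diff_left_mono power_mono u_nonneg) auto
        also have "\<dots> = u r * (r ^ 4 * m ^ 4) * ((exp (\<theta> * m) - 3) / 3) * 3"
          by (simp add: gr algebra_simps)
        also have "\<dots> \<le> u r * (r ^ 4 * m ^ 4) * (exp (\<theta> * m) - exp (\<theta> * m / 2)) * 3"
          using m \<theta> by (intro mult_right_mono mult_left_mono exp_half_gap mult_nonneg_nonneg u_nonneg) auto
        also have "\<dots> = 3072 * (c * (m / 4))"
          by (simp add: c_def power_divide power_numeral_reduce algebra_simps)
        finally have 1: "(u r * (r ^ 4 * m ^ 4 * ?g r) - 3 * (u r * r ^ 8)) / 3072 \<le> c * (m / 4)" by simp
        also have "c * (m / 4) = (\<integral>s. c * indicator {m / 4..m / 2} s \<partial>lborel)"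
          using m by simp
        also have "\<dots> \<le> (\<integral>s. P3 s (r - s) * \<Delta> s (r - s) \<partial>lborel)"
        proof (rule integral_mono)
          show "integrable lborel (\<lambda>s. c * indicator {m / 4..m / 2} s)" using m by simp
          show "integrable lborel (\<lambda>s. P3 s (r - s) * \<Delta> s (r - s))" by (rule elim)
          fix s
          show "c * indicator {m / 4..m / 2} s \<le> P3 s (r - s) * \<Delta> s (r - s)"
          proof (cases "s \<in> {m / 4..m / 2}")
            case s: True
            then have s': "m / 4 \<le> s" "s \<le> m / 2" "0 < s" "r / 2 \<le> r - s" "0 < r - s" using m by auto
            have "?g s \<le> exp (\<theta> * m / 2)"
              using mult_left_mono[of "min s N" "m / 2" \<theta>] s' \<theta> by (simp add: gexp_def)
            then have "exp (\<theta> * m) - exp (\<theta> * m / 2) \<le> ?g r - ?g s" by (simp add: gr)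
            then have "m / 4 * (exp (\<theta> * m) - exp (\<theta> * m / 2)) \<le> s * (?g r - ?g s)"
              using s' m \<theta> by (intro mult_mono) auto
            also have "\<dots> \<le> \<Delta> s (r - s)"
              unfolding \<Delta>_eq[OF s'(3,5)] using gexp_mono[OF \<theta>, of "r - s" r N] s' by simp
            finally have "(m / 4)\<^sup>2 * (r / 2)\<^sup>2 * r\<^sup>2 * (m / 4 * (exp (\<theta> * m) - exp (\<theta> * m / 2)))
                \<le> s\<^sup>2 * (r - s)\<^sup>2 * r\<^sup>2 * \<Delta> s (r - s)"
              using s' m True \<theta> by (intro mult_mono power_mono) (auto intro!: mult_nonneg_nonneg)
            then have "c \<le> u r * (s\<^sup>2 * (r - s)\<^sup>2 * r\<^sup>2 * \<Delta> s (r - s))"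
              unfolding c_def by (rule mult_left_mono) (rule u_nonneg)
            then show ?thesis using s s' by (simp add: P3_def K_def algebra_simps)
          qed (simp add: P\<Delta>_nonneg)
        qed
        finally show ?thesis unfolding m_def .
      qed (auto simp: u_zero not_less P\<Delta>_nonneg intro!: Bochner_Integration.integral_nonneg)
    qed
  qed (use E_int u_integrable8 in auto)
  also have "\<dots> = (\<integral>(x, y). P3 x y * \<Delta> x y \<partial>?M)"
    using lborel_pair.integral_snd[OF I3] integral_shear[of "\<lambda>x y. P3 x y * \<Delta> x y"] I(3)
    by (simp add: \<Delta>_def)
  finally have loss: "(E8 \<theta> N - 3 * (\<integral>r. u r * r ^ 8 \<partial>lborel)) / 3072 \<le> (\<integral>(x, y). P3 x y * \<Delta> x y \<partial>?M)" .
  have "(\<integral>r. collision r * \<psi> r \<partial>lborel) = (\<integral>(x, y). P1 x y * \<Delta> x y \<partial>?M)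
      - 2 * (\<integral>(x, y). P2 x y * \<Delta> x y \<partial>?M) - (\<integral>(x, y). P3 x y * \<Delta> x y \<partial>?M)"
    using W by (simp add: \<Delta>_def)
  then show ?thesis
    using gain cubic loss unfolding \<psi>_def by linarith
qed

end

section \<open>Time derivatives and a barrier argument\<close>

text \<open>The difference is (F s - F t) \<psi> s + F t (\<psi> s - \<psi> t): L^1 continuity meets
  boundedness in the first term, the Lipschitz bound meets integrability in the second.\<close>

lemma integral_product_continuous:
  fixes F \<psi> :: "real \<Rightarrow> 'a \<Rightarrow> real"
  assumes t: "t \<in> I"
    and F: "\<And>s. s \<in> I \<Longrightarrow> integrable M (F s)"
    and lim: "((\<lambda>s. \<integral>x. \<bar>F s x - F t x\<bar> \<partial>M) \<longlongrightarrow> 0) (at t within I)"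
    and \<psi>: "\<And>s. s \<in> I \<Longrightarrow> \<psi> s \<in> borel_measurable M" "\<And>s x. s \<in> I \<Longrightarrow> \<bar>\<psi> s x\<bar> \<le> C"
    and lip: "\<And>s x. s \<in> I \<Longrightarrow> \<bar>\<psi> s x - \<psi> t x\<bar> \<le> L * \<bar>s - t\<bar>"
  shows "((\<lambda>s. \<integral>x. F s x * \<psi> s x \<partial>M) \<longlongrightarrow> (\<integral>x. F t x * \<psi> t x \<partial>M)) (at t within I)"
proof (rule Lim_transform2, rule tendsto_const, rule Lim_null_comparison)
  let ?b = "\<lambda>s. C * (\<integral>x. \<bar>F s x - F t x\<bar> \<partial>M) + (L * \<bar>s - t\<bar>) * (\<integral>x. \<bar>F t x\<bar> \<partial>M)"
  have "(?b \<longlongrightarrow> C * 0 + (L * \<bar>t - t\<bar>) * (\<integral>x. \<bar>F t x\<bar> \<partial>M)) (at t within I)"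
    by (intro tendsto_intros lim)
  then show "(?b \<longlongrightarrow> 0) (at t within I)" by simp
  show "\<forall>\<^sub>F s in at t within I. norm ((\<integral>x. F t x * \<psi> t x \<partial>M) - (\<integral>x. F s x * \<psi> s x \<partial>M)) \<le> ?b s"
    unfolding eventually_at_filter
  proof (intro always_eventually allI impI)
    fix s assume s: "s \<in> I"
    note Fi = F[OF s] F[OF t]
    have i1: "integrable M (\<lambda>x. (F s x - F t x) * \<psi> s x)"
      by (rule integrable_times_bounded[where C = C]) (use s F t \<psi> in auto)
    have i2: "integrable M (\<lambda>x. F t x * (\<psi> s x - \<psi> t x))"
      by (rule integrable_times_bounded[where C = "L * \<bar>s - t\<bar>"]) (use s F t \<psi> lip in auto)
    have "(\<integral>x. F s x * \<psi> s x \<partial>M) - (\<integral>x. F t x * \<psi> t x \<partial>M)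
       = (\<integral>x. (F s x - F t x) * \<psi> s x \<partial>M) + (\<integral>x. F t x * (\<psi> s x - \<psi> t x) \<partial>M)"
    proof -
      have "integrable M (\<lambda>x. F s x * \<psi> s x)" "integrable M (\<lambda>x. F t x * \<psi> t x)"
        using integrable_times_bounded[OF F \<psi>] s t by auto
      then have "(\<integral>x. F s x * \<psi> s x \<partial>M) - (\<integral>x. F t x * \<psi> t x \<partial>M)
        = (\<integral>x. F s x * \<psi> s x - F t x * \<psi> t x \<partial>M)" by simp
      also have "\<dots> = (\<integral>x. (F s x - F t x) * \<psi> s x + F t x * (\<psi> s x - \<psi> t x) \<partial>M)"
        by (simp add: algebra_simps)
      finally show ?thesis using i1 i2 by simp
    qed
    moreover have "\<bar>\<integral>x. (F s x - F t x) * \<psi> s x \<partial>M\<bar> \<le> C * (\<integral>x. \<bar>F s x - F t x\<bar> \<partial>M)"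
    proof -
      have "\<bar>\<integral>x. (F s x - F t x) * \<psi> s x \<partial>M\<bar> \<le> (\<integral>x. \<bar>(F s x - F t x) * \<psi> s x\<bar> \<partial>M)"
        using integral_norm_bound[of M "\<lambda>x. (F s x - F t x) * \<psi> s x"] by simp
      also have "\<dots> \<le> (\<integral>x. C * \<bar>F s x - F t x\<bar> \<partial>M)"
      proof (rule integral_mono)
        show "\<bar>(F s x - F t x) * \<psi> s x\<bar> \<le> C * \<bar>F s x - F t x\<bar>" for x
          using mult_left_mono[OF \<psi>(2)[OF s, of x], of "\<bar>F s x - F t x\<bar>"] by (simp add: abs_mult mult.commute)
      qed (use Fi integrable_abs[OF i1] in auto)
      finally show ?thesis by simp
    qed
    moreover have "\<bar>\<integral>x. F t x * (\<psi> s x - \<psi> t x) \<partial>M\<bar> \<le> (L * \<bar>s - t\<bar>) * (\<integral>x. \<bar>F t x\<bar> \<partial>M)"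
    proof -
      have "\<bar>\<integral>x. F t x * (\<psi> s x - \<psi> t x) \<partial>M\<bar> \<le> (\<integral>x. \<bar>F t x * (\<psi> s x - \<psi> t x)\<bar> \<partial>M)"
        using integral_norm_bound[of M "\<lambda>x. F t x * (\<psi> s x - \<psi> t x)"] by simp
      also have "\<dots> \<le> (\<integral>x. (L * \<bar>s - t\<bar>) * \<bar>F t x\<bar> \<partial>M)"
      proof (rule integral_mono)
        show "\<bar>F t x * (\<psi> s x - \<psi> t x)\<bar> \<le> (L * \<bar>s - t\<bar>) * \<bar>F t x\<bar>" for x
          using mult_left_mono[OF lip[OF s, of x], of "\<bar>F t x\<bar>"] by (simp add: abs_mult mult.commute)
      qed (use Fi integrable_abs[OF i2] in auto)
      finally show ?thesis by simp
    qed
    ultimately show "norm ((\<integral>x. F t x * \<psi> t x \<partial>M) - (\<integral>x. F s x * \<psi> s x \<partial>M)) \<le> ?b s"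
      unfolding real_norm_def by linarith
  qed
qed

text \<open>The quotient of the product is G s \<psi> s + F t p s, where G and p are the quotients
  of the two factors. Filling in \<open>q\<close> and \<open>\<psi>'\<close> at s = t turns both
  into families to which \<open>integral_product_continuous\<close> applies; the Taylor bound,
  uniform in x, is the Lipschitz bound for p.\<close>

lemma integral_product_has_derivative:
  fixes F \<psi> :: "real \<Rightarrow> 'a \<Rightarrow> real"
  assumes t: "t \<in> I"
    and F: "\<And>s. s \<in> I \<Longrightarrow> integrable M (F s)" and q: "integrable M q"
    and lim: "((\<lambda>s. \<integral>x. \<bar>(F s x - F t x) / (s - t) - q x\<bar> \<partial>M) \<longlongrightarrow> 0) (at t within I)"
    and \<psi>: "\<And>s. s \<in> I \<Longrightarrow> \<psi> s \<in> borel_measurable M" "\<And>s x. s \<in> I \<Longrightarrow> \<bar>\<psi> s x\<bar> \<le> C"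
    and \<psi>': "\<psi>' \<in> borel_measurable M" "\<And>x. \<bar>\<psi>' x\<bar> \<le> L"
    and lip: "\<And>s x. s \<in> I \<Longrightarrow> \<bar>\<psi> s x - \<psi> t x\<bar> \<le> L * \<bar>s - t\<bar>"
    and taylor: "\<And>s x. s \<in> I \<Longrightarrow> \<bar>\<psi> s x - \<psi> t x - (s - t) * \<psi>' x\<bar> \<le> L * (s - t)\<^sup>2"
  shows "((\<lambda>s. \<integral>x. F s x * \<psi> s x \<partial>M) has_real_derivative
      (\<integral>x. q x * \<psi> t x \<partial>M) + (\<integral>x. F t x * \<psi>' x \<partial>M)) (at t within I)"
  unfolding has_field_derivative_iff
proof -
  define G where "G s x = (F s x - F t x) / (s - t)" for s x
  define p where "p s x = (\<psi> s x - \<psi> t x) / (s - t)" for s x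
  have Fp: "((\<lambda>s. \<integral>x. F t x * p' s x \<partial>M) \<longlongrightarrow> (\<integral>x. F t x * \<psi>' x \<partial>M)) (at t within I)"
    if "p' = (\<lambda>s. if s = t then \<psi>' else p s)" for p'
  proof -
    have pb: "\<bar>p' s x - \<psi>' x\<bar> \<le> L * \<bar>s - t\<bar>" if s: "s \<in> I" for s x
    proof (cases "s = t")
      case False
      have "\<bar>p s x - \<psi>' x\<bar> = \<bar>\<psi> s x - \<psi> t x - (s - t) * \<psi>' x\<bar> / \<bar>s - t\<bar>"
        unfolding p_def abs_divide[symmetric] using False by (simp add: diff_divide_distrib)
      also have "\<dots> \<le> L * (s - t)\<^sup>2 / \<bar>s - t\<bar>"
        by (rule divide_right_mono[OF taylor[OF s]]) simp
      also have "(s - t)\<^sup>2 = \<bar>s - t\<bar> * \<bar>s - t\<bar>" by (simp add: power2_eq_square)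
      also have "L * (\<bar>s - t\<bar> * \<bar>s - t\<bar>) / \<bar>s - t\<bar> = L * \<bar>s - t\<bar>"
        using False nonzero_mult_div_cancel_right[of "\<bar>s - t\<bar>" "L * \<bar>s - t\<bar>"]
        unfolding mult.assoc by simp
      finally show ?thesis using False by (simp add: \<open>p' = _\<close>)
    qed (simp add: \<open>p' = _\<close>)
    have pC: "\<bar>p' s x\<bar> \<le> L" if s: "s \<in> I" for s x
    proof (cases "s = t")
      case False
      then have "\<bar>p s x\<bar> \<le> L" using lip[OF s, of x] by (simp add: p_def divide_le_eq)
      with False show ?thesis by (simp add: \<open>p' = _\<close>)
    qed (simp add: \<open>p' = _\<close> \<psi>')
    have "((\<lambda>s. \<integral>x. F t x * p' s x \<partial>M) \<longlongrightarrow> (\<integral>x. F t x * p' t x \<partial>M)) (at t within I)"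
      by (rule integral_product_continuous[where C = L and L = L])
        (use t F pb pC \<psi> \<psi>' in \<open>auto simp: \<open>p' = _\<close> p_def[abs_def]\<close>)
    then show ?thesis by (simp add: \<open>p' = _\<close>)
  qed
  have G: "((\<lambda>s. \<integral>x. G' s x * \<psi> s x \<partial>M) \<longlongrightarrow> (\<integral>x. q x * \<psi> t x \<partial>M)) (at t within I)"
    if "G' = (\<lambda>s. if s = t then q else G s)" for G'
  proof -
    have "((\<lambda>s. \<integral>x. G' s x * \<psi> s x \<partial>M) \<longlongrightarrow> (\<integral>x. G' t x * \<psi> t x \<partial>M)) (at t within I)"
    proof (rule integral_product_continuous[where C = C and L = L])
      show "((\<lambda>s. \<integral>x. \<bar>G' s x - G' t x\<bar> \<partial>M) \<longlongrightarrow> 0) (at t within I)"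
        by (rule Lim_transform_eventually[OF lim])
          (auto simp: eventually_at_filter that G_def)
    qed (use t F q \<psi> lip in \<open>auto simp: that G_def[abs_def]\<close>)
    then show ?thesis by (simp add: that)
  qed
  have "((\<lambda>s. (\<integral>x. (if s = t then q else G s) x * \<psi> s x \<partial>M) + (\<integral>x. F t x * (if s = t then \<psi>' else p s) x \<partial>M))
     \<longlongrightarrow> (\<integral>x. q x * \<psi> t x \<partial>M) + (\<integral>x. F t x * \<psi>' x \<partial>M)) (at t within I)"
    by (rule tendsto_add[OF G[OF refl] Fp[OF refl]])
  then show "((\<lambda>s. ((\<integral>x. F s x * \<psi> s x \<partial>M) - (\<integral>x. F t x * \<psi> t x \<partial>M)) / (s - t))
     \<longlongrightarrow> (\<integral>x. q x * \<psi> t x \<partial>M) + (\<integral>x. F t x * \<psi>' x \<partial>M)) (at t within I)"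
  proof (rule Lim_transform_eventually)
    show "\<forall>\<^sub>F s in at t within I. (\<integral>x. (if s = t then q else G s) x * \<psi> s x \<partial>M) + (\<integral>x. F t x * (if s = t then \<psi>' else p s) x \<partial>M)
      = ((\<integral>x. F s x * \<psi> s x \<partial>M) - (\<integral>x. F t x * \<psi> t x \<partial>M)) / (s - t)"
      unfolding eventually_at_filter
    proof (intro always_eventually allI impI)
      fix s assume s: "s \<noteq> t" "s \<in> I"
      have i: "integrable M (\<lambda>x. F s x * \<psi> s x)" "integrable M (\<lambda>x. F t x * \<psi> s x)" "integrable M (\<lambda>x. F t x * \<psi> t x)"
        using integrable_times_bounded[OF F \<psi>] s t by auto
      have "(\<integral>x. G s x * \<psi> s x \<partial>M) = (\<integral>x. (F s x * \<psi> s x - F t x * \<psi> s x) / (s - t) \<partial>M)"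
        by (simp add: G_def algebra_simps)
      also have "\<dots> = ((\<integral>x. F s x * \<psi> s x \<partial>M) - (\<integral>x. F t x * \<psi> s x \<partial>M)) / (s - t)"
        using i by simp
      finally have 1: "(\<integral>x. G s x * \<psi> s x \<partial>M) = \<dots>" .
      have "(\<integral>x. F t x * p s x \<partial>M) = (\<integral>x. (F t x * \<psi> s x - F t x * \<psi> t x) / (s - t) \<partial>M)"
        by (simp add: p_def algebra_simps)
      also have "\<dots> = ((\<integral>x. F t x * \<psi> s x \<partial>M) - (\<integral>x. F t x * \<psi> t x \<partial>M)) / (s - t)"
        using i by simp
      finally show "(\<integral>x. (if s = t then q else G s) x * \<psi> s x \<partial>M) + (\<integral>x. F t x * (if s = t then \<psi>' else p s) x \<partial>M)
        = ((\<integral>x. F s x * \<psi> s x \<partial>M) - (\<integral>x. F t x * \<psi> t x \<partial>M)) / (s - t)"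
        using s 1 by (simp add: add_divide_distrib[symmetric])
    qed
  qed
qed

text \<open>The derivative is controlled only while G lies between \<open>B0\<close> and
  \<open>B\<close>. Between the last time below \<open>B0\<close> and the first later crossing of a
  level within the window, the mean value theorem limits the rise to d (b - a), so no level above
  the claimed bound is ever reached.\<close>

lemma barrier:
  fixes G :: "real \<Rightarrow> real"
  assumes cont: "continuous_on {a..b} G"
    and der: "\<And>t. a < t \<Longrightarrow> t < b \<Longrightarrow> (G has_real_derivative G' t) (at t)"
    and le: "\<And>t. a < t \<Longrightarrow> t < b \<Longrightarrow> B0 \<le> G t \<Longrightarrow> G t \<le> B \<Longrightarrow> G' t \<le> d"
    and d: "0 \<le> d" and Ga: "G a \<le> B0" and B: "B0 + d * (b - a) < B"
    and t: "t \<in> {a..b}"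
  shows "G t \<le> B0 + d * (b - a)"
proof (rule ccontr)
  assume neg: "\<not> ?thesis"
  \<comment> \<open>A level strictly above the claimed bound that G attains or exceeds at time t and
    that does not exceed \<open>B\<close>: before its first crossing, G cannot leave the window at
    the top.\<close>
  define v where "v = min (G t) B"
  have v: "B0 + d * (b - a) < v" "v \<le> G t" "v \<le> B" using neg B by (auto simp: v_def)
  have "0 \<le> d * (b - a)" using d t by simp
  then have v0: "B0 < v" using v by simp
  let ?S = "{a..b} \<inter> G -` {v..}"
  have "closed ?S" by (rule continuous_closed_preimage[OF cont]) auto
  then have "compact ?S" using compact_Int_closed[of "{a..b}" ?S] by (simp add: Int_assoc[symmetric])
  moreover have "?S \<noteq> {}" using t v by auto
  ultimately obtain t2 where t2: "t2 \<in> ?S" "\<And>s. s \<in> ?S \<Longrightarrow> t2 \<le> s"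
    using continuous_attains_inf[of ?S "\<lambda>x. x"] continuous_on_id by blast
  let ?R = "{a..t2} \<inter> G -` {..B0}"
  have cont2: "continuous_on {a..t2} G" using t2 by (intro continuous_on_subset[OF cont]) auto
  have "closed ?R" by (rule continuous_closed_preimage[OF cont2]) auto
  then have "compact ?R" using compact_Int_closed[of "{a..t2}" ?R] by (simp add: Int_assoc[symmetric])
  moreover have "?R \<noteq> {}" using t2 Ga by auto
  ultimately obtain t3 where t3: "t3 \<in> ?R" "\<And>s. s \<in> ?R \<Longrightarrow> s \<le> t3"
    using continuous_attains_sup[of ?R "\<lambda>x. x"] continuous_on_id by blast
  have lt: "t3 < t2" using t3(1) t2(1) v0 by (cases "t3 = t2") auto
  obtain l z where z: "t3 < z" "z < t2" "(G has_real_derivative l) (at z)" "G t2 - G t3 = (t2 - t3) * l"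
  proof (rule MVT[OF lt, of G, elim_format])
    show "continuous_on {t3..t2} G" using t2 t3 by (intro continuous_on_subset[OF cont]) auto
    show "G differentiable (at x)" if "t3 < x" "x < t2" for x
      using der[of x] that t2 t3 by (auto simp: real_differentiable_def)
  qed auto
  have "l = G' z" using DERIV_unique[OF z(3) der[of z]] z t2 t3 by auto
  moreover have "G' z \<le> d"
  proof (rule le)
    show "B0 \<le> G z" using t3(2)[of z] t3(1) z by force
    have "\<not> v \<le> G z" using t2(2)[of z] t2(1) t3(1) z by auto
    then show "G z \<le> B" using v by simp
  qed (use z t2 t3 in auto)
  ultimately have "G t2 - G t3 \<le> (t2 - t3) * d" using z lt by (simp add: mult_left_mono)
  also have "\<dots> \<le> (b - a) * d" using d t2 t3 by (intro mult_right_mono) auto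
  finally show False using v t2(1) t3(1) by (simp add: mult.commute)
qed

text \<open>Everything comes from the tangent inequality for exp. Applied at both points it bounds
  the second-order remainder by (x - y)(exp x - exp y), to which the Lipschitz estimate is applied
  once more.\<close>

lemma
  fixes x y N :: real
  assumes "x \<le> N" "y \<le> N"
  shows exp_lipschitz: "\<bar>exp x - exp y\<bar> \<le> exp N * \<bar>x - y\<bar>"
    and exp_taylor2: "\<bar>exp x - exp y - (x - y) * exp y\<bar> \<le> exp N * (x - y)\<^sup>2"
proof -
  have tangent: "(b - a) * exp a \<le> exp b - exp a" for a b :: real
    using mult_right_mono[OF exp_ge_add_one_self[of "b - a"], of "exp a"]
    by (simp add: exp_diff algebra_simps)
  have up: "exp b - exp a \<le> exp N * \<bar>b - a\<bar>" if "b \<le> N" for a b :: real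
  proof -
    have "exp b - exp a \<le> (b - a) * exp b" using tangent[of a b] by (simp add: algebra_simps)
    also have "\<dots> \<le> \<bar>b - a\<bar> * exp N" using that by (intro mult_mono) auto
    finally show ?thesis by (simp add: mult.commute)
  qed
  show lip: "\<bar>exp x - exp y\<bar> \<le> exp N * \<bar>x - y\<bar>"
    using up[of x y] up[of y x] assms by (auto simp: abs_if)
  have "exp x - exp y - (x - y) * exp y \<le> (x - y) * (exp x - exp y)"
    using tangent[of y x] tangent[of x y] by (simp add: algebra_simps)
  also have "\<dots> \<le> \<bar>x - y\<bar> * \<bar>exp x - exp y\<bar>" by (simp flip: abs_mult)
  also have "\<dots> \<le> \<bar>x - y\<bar> * (exp N * \<bar>x - y\<bar>)" by (intro mult_left_mono lip) auto
  also have "\<dots> = exp N * (x - y)\<^sup>2" by (simp add: power2_eq_square)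
  finally show "\<bar>exp x - exp y - (x - y) * exp y\<bar> \<le> exp N * (x - y)\<^sup>2"
    using tangent[of x y] by simp
qed

text \<open>The derivative of \<open>cut_test \<theta> N r\<close> in \<open>\<theta>\<close>.\<close>

definition cut_test' :: "real \<Rightarrow> real \<Rightarrow> real \<Rightarrow> real" where
  "cut_test' \<theta> N r = pos r * r * (min r N * gexp \<theta> N r - N * exp (\<theta> * N))"

lemma cut_test'_measurable [measurable]: "cut_test' \<theta> N \<in> borel_measurable borel"
  unfolding cut_test'_def by measurable

text \<open>On the support r < N, so the two exponentials, at r and at N, obey the same estimate;
  this gives the factor 2, and the prefactor r gives another N. The constants grow with N, but they
  only justify differentiation at fixed N and enter no final bound.\<close>

lemma cut_test_estimates:
  assumes \<theta>: "0 \<le> \<theta>" "\<theta> \<le> 1" and \<eta>: "0 \<le> \<eta>" "\<eta> \<le> 1" and N: "0 < N"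
  shows "\<bar>cut_test \<theta> N r - cut_test \<eta> N r\<bar> \<le> (2 * N * N * exp N) * \<bar>\<theta> - \<eta>\<bar>"
    and "\<bar>cut_test \<theta> N r - cut_test \<eta> N r - (\<theta> - \<eta>) * cut_test' \<eta> N r\<bar> \<le> (2 * N * N\<^sup>2 * exp N) * (\<theta> - \<eta>)\<^sup>2"
    and "\<bar>cut_test' \<eta> N r\<bar> \<le> 2 * N * N * exp N"
proof (atomize (full), cases "0 < r \<and> r < N")
  case True
  have le: "\<theta> * a \<le> N" "\<eta> * a \<le> N" if "0 \<le> a" "a \<le> N" for a
    using mult_mono[of \<theta> 1 a N] mult_mono[of \<eta> 1 a N] that \<theta> \<eta> N by auto
  have lip: "\<bar>exp (\<theta> * a) - exp (\<eta> * a)\<bar> \<le> N * exp N * \<bar>\<theta> - \<eta>\<bar>" if "0 \<le> a" "a \<le> N" for a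
  proof -
    have "\<bar>exp (\<theta> * a) - exp (\<eta> * a)\<bar> \<le> exp N * \<bar>\<theta> * a - \<eta> * a\<bar>" by (rule exp_lipschitz[OF le[OF that]])
    also have "\<dots> = exp N * (\<bar>\<theta> - \<eta>\<bar> * a)" using that by (simp add: left_diff_distrib[symmetric] abs_mult)
    also have "\<dots> \<le> exp N * (\<bar>\<theta> - \<eta>\<bar> * N)" using that by (intro mult_left_mono) auto
    finally show ?thesis by (simp add: mult_ac)
  qed
  have tay: "\<bar>exp (\<theta> * a) - exp (\<eta> * a) - (\<theta> - \<eta>) * (a * exp (\<eta> * a))\<bar> \<le> N\<^sup>2 * exp N * (\<theta> - \<eta>)\<^sup>2"
    if "0 \<le> a" "a \<le> N" for a
  proof -
    have "\<bar>exp (\<theta> * a) - exp (\<eta> * a) - (\<theta> * a - \<eta> * a) * exp (\<eta> * a)\<bar> \<le> exp N * (\<theta> * a - \<eta> * a)\<^sup>2"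
      by (rule exp_taylor2[OF le[OF that]])
    also have "\<dots> = exp N * ((\<theta> - \<eta>)\<^sup>2 * a\<^sup>2)" by (simp add: left_diff_distrib[symmetric] power_mult_distrib)
    also have "\<dots> \<le> exp N * ((\<theta> - \<eta>)\<^sup>2 * N\<^sup>2)" using that by (intro mult_left_mono power_mono) auto
    finally show ?thesis by (simp add: algebra_simps)
  qed
  have r: "min r N = r" "0 \<le> r" "r \<le> N" using True by auto
  have N0: "0 \<le> N" "N \<le> N" using N by auto
  have le2: "\<bar>r * (A - B)\<bar> \<le> N * (2 * C)" if "\<bar>A\<bar> \<le> C" "\<bar>B\<bar> \<le> C" for A B C
    using mult_mono[of r N "\<bar>A - B\<bar>" "2 * C"] that r by (simp add: abs_mult)
  have "\<bar>cut_test \<theta> N r - cut_test \<eta> N r\<bar> \<le> N * (2 * (N * exp N * \<bar>\<theta> - \<eta>\<bar>))"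
    using le2[OF lip[OF r(2,3)] lip[OF N0]] True r by (simp add: cut_test_def gexp_def algebra_simps)
  moreover have "\<bar>cut_test \<theta> N r - cut_test \<eta> N r - (\<theta> - \<eta>) * cut_test' \<eta> N r\<bar> \<le> N * (2 * (N\<^sup>2 * exp N * (\<theta> - \<eta>)\<^sup>2))"
    using le2[OF tay[OF r(2,3)] tay[OF N0]] True r
    by (simp add: cut_test_def cut_test'_def gexp_def algebra_simps)
  moreover have "\<bar>cut_test' \<eta> N r\<bar> \<le> N * (2 * (N * exp N))"
  proof -
    have "\<bar>r * exp (\<eta> * r)\<bar> \<le> N * exp N" "\<bar>N * exp (\<eta> * N)\<bar> \<le> N * exp N"
      using le[OF r(2,3)] le[OF N0] r N by (auto simp: abs_mult intro!: mult_mono)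
    from le2[OF this] show ?thesis using True r by (simp add: cut_test'_def gexp_def)
  qed
  ultimately show "\<bar>cut_test \<theta> N r - cut_test \<eta> N r\<bar> \<le> (2 * N * N * exp N) * \<bar>\<theta> - \<eta>\<bar> \<and>
    \<bar>cut_test \<theta> N r - cut_test \<eta> N r - (\<theta> - \<eta>) * cut_test' \<eta> N r\<bar> \<le> (2 * N * N\<^sup>2 * exp N) * (\<theta> - \<eta>)\<^sup>2 \<and>
    \<bar>cut_test' \<eta> N r\<bar> \<le> 2 * N * N * exp N"
    by (simp add: algebra_simps)
next
  case False
  then have "cut_test \<theta> N r = 0" "cut_test \<eta> N r = 0" "cut_test' \<eta> N r = 0"
    by (auto simp: cut_test_def cut_test'_def gexp_def)
  then show "\<bar>cut_test \<theta> N r - cut_test \<eta> N r\<bar> \<le> (2 * N * N * exp N) * \<bar>\<theta> - \<eta>\<bar> \<and>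
    \<bar>cut_test \<theta> N r - cut_test \<eta> N r - (\<theta> - \<eta>) * cut_test' \<eta> N r\<bar> \<le> (2 * N * N\<^sup>2 * exp N) * (\<theta> - \<eta>)\<^sup>2 \<and>
    \<bar>cut_test' \<eta> N r\<bar> \<le> 2 * N * N * exp N"
    using N by simp
qed

section \<open>Profiles in the solution space\<close>

text \<open>A representative without junk values: nonnegative everywhere and zero off the positive axis.\<close>

definition clean :: "(real \<Rightarrow> real) \<Rightarrow> real \<Rightarrow> real" where
  "clean f r = pos r * max 0 (f r)"

lemma clean_eq_AE:
  assumes "radial_L1 f" "radial_nonneg f"
  shows "AE r in lborel. 0 < r \<longrightarrow> f r = clean f r"
proof -
  have [measurable]: "(\<lambda>r. indicator {0..} r * f r) \<in> borel_measurable borel"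
    by (rule profile_measurable) (use assms(1) in \<open>auto simp: radial_L1_def\<close>)
  have "{r. 0 \<le> r \<and> 0 \<le> f r} = {r. 0 \<le> r \<and> 0 \<le> indicator {0..} r * f r}"
    by auto
  also have "\<dots> \<in> sets borel" by measurable
  finally have "AE r in lborel. 0 < r \<longrightarrow> 0 \<le> f r"
    using assms(2) unfolding radial_nonneg_def by (intro AE_norm_R3)
  then show ?thesis by eventually_elim (auto simp: clean_def)
qed

lemma clean_measurable:
  assumes "radial_L1 f"
  shows "clean f \<in> borel_measurable borel"
proof -
  have [measurable]: "(\<lambda>r. indicator {0..} r * f r) \<in> borel_measurable borel"
    by (rule profile_measurable) (use assms in \<open>auto simp: radial_L1_def\<close>)
  have "(\<lambda>r. pos r * max 0 (indicator {0..} r * f r)) \<in> borel_measurable borel" by measurable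
  also have "(\<lambda>r. pos r * max 0 (indicator {0..} r * f r)) = clean f"
    by (auto simp: clean_def fun_eq_iff indicator_def)
  finally show ?thesis .
qed

lemma set_integral_clean:
  assumes f: "radial_L1 f" "radial_nonneg f" and [measurable]: "h \<in> borel_measurable borel"
  shows "set_integrable lborel {0..} (\<lambda>r. f r * h r) \<longleftrightarrow> integrable lborel (\<lambda>r. clean f r * h r)"
    and "(LBINT r:{0..}. f r * h r) = (\<integral>r. clean f r * h r \<partial>lborel)"
proof -
  have m [measurable]: "(\<lambda>r. indicator {0..} r * f r) \<in> borel_measurable borel"
    by (rule profile_measurable) (use f in \<open>auto simp: radial_L1_def\<close>)
  have m1: "(\<lambda>r. indicator {0..} r *\<^sub>R (f r * h r)) \<in> borel_measurable lborel"
    using borel_measurable_times[OF m assms(3)] by (simp add: mult.assoc)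
  have m2: "(\<lambda>r. clean f r * h r) \<in> borel_measurable lborel"
    using clean_measurable[OF f(1)] by simp
  have "AE r in lborel. r \<noteq> (0::real)" by (rule AE_lborel_singleton)
  with clean_eq_AE[OF f] have ae: "AE r in lborel. indicator {0..} r *\<^sub>R (f r * h r) = clean f r * h r"
    by eventually_elim (auto simp: indicator_def clean_def)
  show "set_integrable lborel {0..} (\<lambda>r. f r * h r) \<longleftrightarrow> integrable lborel (\<lambda>r. clean f r * h r)"
    unfolding set_integrable_def by (rule integrable_cong_AE[OF m1 m2 ae])
  show "(LBINT r:{0..}. f r * h r) = (\<integral>r. clean f r * h r \<partial>lborel)"
    unfolding set_lebesgue_integral_def by (rule integral_cong_AE[OF m1 m2 ae])
qed

lemma S_set_profile:
  assumes "f \<in> S_set h3 h8 hinf"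
  shows "profile (clean f)"
    and "moment 2 f = (\<integral>r. clean f r * r ^ 2 \<partial>lborel)"
    and "(\<integral>r. clean f r * r ^ 3 \<partial>lborel) = h3"
    and "(\<integral>r. clean f r * r ^ 8 \<partial>lborel) \<le> h8"
proof -
  have f: "radial_L1 f" "radial_nonneg f" using assms by (auto simp: S_set_def)
  note c = set_integral_clean[OF f, of "\<lambda>r. r ^ k" for k]
  have "integrable lborel (\<lambda>r. clean f r * r\<^sup>2)"
    using f(1) integrable_norm_R3[of f] c(1)[of 2] unfolding radial_L1_def by auto
  moreover have "integrable lborel (\<lambda>r. clean f r * r ^ 8)"
    using assms c(1)[of 8] by (auto simp: S_set_def has_moment_def)
  ultimately show "profile (clean f)"
    by unfold_locales (auto simp: clean_measurable[OF f(1)] clean_def)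
  show "moment 2 f = (\<integral>r. clean f r * r ^ 2 \<partial>lborel)" "(\<integral>r. clean f r * r ^ 3 \<partial>lborel) = h3"
    "(\<integral>r. clean f r * r ^ 8 \<partial>lborel) \<le> h8"
    using assms c(2)[of 2] c(2)[of 3] c(2)[of 8] by (auto simp: S_set_def moment_def)
qed

text \<open>Translations and reflections preserve null sets, so at fixed r each inner integral sees
  only the cleaned profile. The cut-off \<open>F\<close> is interposed for measurability, as the
  values of \<open>f\<close> at negative arguments are arbitrary.\<close>

lemma Q_clean:
  assumes f: "radial_L1 f" "radial_nonneg f" "profile (clean f)"
  shows "AE r in lborel. 0 < r \<longrightarrow> Q f r * r\<^sup>2 = profile.collision (clean f) r"
proof -
  interpret profile "clean f" by (rule f(3))
  let ?u = "clean f"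
  define F where "F r = indicator {0..} r * f r" for r
  have F_m [measurable]: "F \<in> borel_measurable borel"
    unfolding F_def[abs_def] by (rule profile_measurable) (use f in \<open>auto simp: radial_L1_def\<close>)
  have Ff: "F r = f r" if "0 \<le> r" for r using that by (simp add: F_def)
  have F: "AE r in lborel. 0 < r \<longrightarrow> F r = ?u r"
    using clean_eq_AE[OF f(1,2)] by eventually_elim (auto simp: F_def)
  have n0: "AE r in lborel. r \<noteq> (c::real)" for c by (rule AE_lborel_singleton)
  show ?thesis using F
  proof eventually_elim
    case (elim r)
    show ?case
    proof
      assume r: "0 < r"
      have fr: "f r = ?u r" using elim r Ff[of r] by simp
      have F_refl: "AE s in lborel. 0 < r - s \<longrightarrow> F (r - s) = ?u (r - s)"
        using AE_borel_affine[OF _ _ F, of "-1" r] by simp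
      have F_shift: "AE s in lborel. 0 < s - r \<longrightarrow> F (s - r) = ?u (s - r)"
        using AE_borel_affine[OF _ _ F, of 1 "- r"] by simp
      have "(LBINT s:{0..r}. K s (r - s) * f s * f (r - s)) = (LBINT s:{0..r}. K s (r - s) * F s * F (r - s))"
        by (rule set_lebesgue_integral_cong) (auto simp: Ff)
      also have "\<dots> = (\<integral>s. K s (r - s) * ?u s * ?u (r - s) \<partial>lborel)"
        unfolding set_lebesgue_integral_def
      proof (rule integral_cong_AE)
        show "AE s in lborel. indicator {0..r} s *\<^sub>R (K s (r - s) * F s * F (r - s)) = K s (r - s) * ?u s * ?u (r - s)"
          using F F_refl n0[of 0] n0[of r]
          by eventually_elim (auto simp: indicator_def u_zero)
      qed measurable
      finally have 1: "(LBINT s:{0..r}. K s (r - s) * f s * f (r - s)) = \<dots>" .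
      have "(LBINT s:{r..}. K r (s - r) * f s * f (s - r)) = (LBINT s:{r..}. K r (s - r) * F s * F (s - r))"
        by (rule set_lebesgue_integral_cong) (use r in \<open>auto simp: Ff\<close>)
      also have "\<dots> = (\<integral>s. K r (s - r) * ?u s * ?u (s - r) \<partial>lborel)"
        unfolding set_lebesgue_integral_def
      proof (rule integral_cong_AE)
        show "AE s in lborel. indicator {r..} s *\<^sub>R (K r (s - r) * F s * F (s - r)) = K r (s - r) * ?u s * ?u (s - r)"
          using F F_shift n0[of 0] n0[of r]
          by eventually_elim (use r in \<open>auto simp: indicator_def u_zero\<close>)
      qed measurable
      finally have 2: "(LBINT s:{r..}. K r (s - r) * f s * f (s - r)) = \<dots>" .
      have "(LBINT s:{r..}. K r (s - r) * f s) = (LBINT s:{r..}. K r (s - r) * F s)"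
        by (rule set_lebesgue_integral_cong) (use r in \<open>auto simp: Ff\<close>)
      also have "\<dots> = (\<integral>s. K r (s - r) * ?u s * pos (s - r) \<partial>lborel)"
        unfolding set_lebesgue_integral_def
      proof (rule integral_cong_AE)
        show "AE s in lborel. indicator {r..} s *\<^sub>R (K r (s - r) * F s) = K r (s - r) * ?u s * pos (s - r)"
          using F n0[of 0] n0[of r]
          by eventually_elim (use r in \<open>auto simp: indicator_def u_zero\<close>)
      qed measurable
      finally have 3: "(LBINT s:{r..}. K r (s - r) * f s) = \<dots>" .
      have "(LBINT s:{0..r}. K s (r - s) * f s) = (LBINT s:{0..r}. K s (r - s) * F s)"
        by (rule set_lebesgue_integral_cong) (auto simp: Ff)
      also have "\<dots> = (\<integral>s. K s (r - s) * ?u s * pos (r - s) \<partial>lborel)"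
        unfolding set_lebesgue_integral_def
      proof (rule integral_cong_AE)
        show "AE s in lborel. indicator {0..r} s *\<^sub>R (K s (r - s) * F s) = K s (r - s) * ?u s * pos (r - s)"
          using F n0[of 0] n0[of r]
          by eventually_elim (auto simp: indicator_def u_zero)
      qed measurable
      finally have 4: "(LBINT s:{0..r}. K s (r - s) * f s) = \<dots>" .
      have "(LBINT s:{0..}. K r s * f s) = (LBINT s:{0..}. K r s * F s)"
        by (rule set_lebesgue_integral_cong) (auto simp: Ff)
      also have "\<dots> = (\<integral>s. K r s * ?u s \<partial>lborel)"
        unfolding set_lebesgue_integral_def
      proof (rule integral_cong_AE)
        show "AE s in lborel. indicator {0..} s *\<^sub>R (K r s * F s) = K r s * ?u s"
          using F n0[of 0] by eventually_elim (auto simp: indicator_def u_zero)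
      qed measurable
      finally have 5: "(LBINT s:{0..}. K r s * f s) = \<dots>" .
      have 6: "(LBINT s:{0..r}. K s (r - s)) = (\<integral>s. K s (r - s) * pos s * pos (r - s) \<partial>lborel)"
        unfolding set_lebesgue_integral_def
      proof (rule integral_cong_AE)
        show "AE s in lborel. indicator {0..r} s *\<^sub>R K s (r - s) = K s (r - s) * pos s * pos (r - s)"
          using n0[of 0] n0[of r] by eventually_elim (auto simp: indicator_def)
      qed measurable
      show "Q f r * r\<^sup>2 = collision r"
        using r unfolding Q_def Q_quad_def L_lin_def 1 2 3 4 5 6 collision_def fr by simp
    qed
  qed
qed

section \<open>Solutions of the coupled system\<close>

locale kinetic =
  fixes \<kappa> h3 h8 hinf n0 :: real and f0 :: "real \<Rightarrow> real" and f :: "real \<Rightarrow> real \<Rightarrow> real"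
    and nc :: "real \<Rightarrow> real"
  assumes \<kappa>_pos: "0 < \<kappa>" and h3_pos: "0 < h3" and n0_pos: "0 < n0"
    and sol: "solution \<kappa> (S_set h3 h8 hinf) {0..} f0 n0 f nc"
begin

abbreviation U :: "real \<Rightarrow> real \<Rightarrow> real" where "U t \<equiv> clean (f t)"

lemma f_in: "0 \<le> t \<Longrightarrow> f t \<in> S_set h3 h8 hinf"
  using sol by (auto simp: solution_def)

lemma f_L1: "0 \<le> t \<Longrightarrow> radial_L1 (f t)" and f_nonneg: "0 \<le> t \<Longrightarrow> radial_nonneg (f t)"
  using f_in by (auto simp: S_set_def)

lemma U_profile: "0 \<le> t \<Longrightarrow> profile (U t)"
  using S_set_profile(1)[OF f_in] .

lemma U_moments:
  assumes "0 \<le> t"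
  shows "(\<integral>r. U t r * r ^ 2 \<partial>lborel) = moment 2 (f t)" "(\<integral>r. U t r * r ^ 3 \<partial>lborel) = h3"
    "(\<integral>r. U t r * r ^ 8 \<partial>lborel) \<le> h8" "0 \<le> moment 2 (f t)" "0 \<le> h8"
    "(\<integral>r. U t r * r ^ 4 \<partial>lborel) \<le> h3 + h8" "(\<integral>r. U t r * r ^ 7 \<partial>lborel) \<le> moment 2 (f t) + h8"
    "0 \<le> (\<integral>r. U t r * r ^ 4 \<partial>lborel)"
proof -
  interpret profile "U t" by (rule U_profile[OF assms])
  note m = S_set_profile[OF f_in[OF assms]]
  have nn: "0 \<le> (\<integral>r. U t r * r ^ k \<partial>lborel)" for k
    by (rule Bochner_Integration.integral_nonneg) (auto simp: clean_def indicator_def)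
  show "(\<integral>r. U t r * r ^ 2 \<partial>lborel) = moment 2 (f t)" "(\<integral>r. U t r * r ^ 3 \<partial>lborel) = h3"
    "(\<integral>r. U t r * r ^ 8 \<partial>lborel) \<le> h8" "0 \<le> moment 2 (f t)" "0 \<le> h8"
    "0 \<le> (\<integral>r. U t r * r ^ 4 \<partial>lborel)"
    using m nn[of 2] nn[of 8] nn[of 4] by auto
  have "1 * (\<integral>r. U t r * r ^ 4 \<partial>lborel) \<le> 1 * (\<integral>r. U t r * r ^ 3 \<partial>lborel) + 1 * (\<integral>r. U t r * r ^ 8 \<partial>lborel)"
  proof (rule weighted_mono)
    fix r :: real assume "0 < r"
    then show "1 * r ^ 4 \<le> 1 * r ^ 3 + 1 * r ^ 8"
      using power_decreasing[of 3 4 r] power_increasing[of 4 8 r] zero_le_power[of r 3] zero_le_power[of r 8]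
      by (cases "r \<le> 1"; linarith)
  qed (auto intro: integrable_power)
  then show "(\<integral>r. U t r * r ^ 4 \<partial>lborel) \<le> h3 + h8" using m by simp
  have "1 * (\<integral>r. U t r * r ^ 7 \<partial>lborel) \<le> 1 * (\<integral>r. U t r * r ^ 2 \<partial>lborel) + 1 * (\<integral>r. U t r * r ^ 8 \<partial>lborel)"
    by (rule weighted_mono) (use power_between[of _ 7] in \<open>auto intro: integrable_power\<close>)
  then show "(\<integral>r. U t r * r ^ 7 \<partial>lborel) \<le> moment 2 (f t) + h8" using m by simp
qed

lemma integral_f_R3:
  assumes "0 \<le> t" and [measurable]: "\<psi> \<in> borel_measurable borel"
  shows "(\<integral>p. f t (norm (p::real^3)) * \<psi> (norm p) \<partial>lborel) = 4 * pi * (\<integral>r. U t r * (\<psi> r * r\<^sup>2) \<partial>lborel)"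
proof -
  have [measurable]: "(\<lambda>p::real^3. f t (norm p)) \<in> borel_measurable lborel"
    using f_L1[OF assms(1)] by (auto simp: radial_L1_def)
  have "(\<integral>p. f t (norm (p::real^3)) * \<psi> (norm p) \<partial>lborel) = 4 * pi * (LBINT r:{0..}. f t r * \<psi> r * r\<^sup>2)"
    by (rule integral_norm_R3) measurable
  also have "(LBINT r:{0..}. f t r * \<psi> r * r\<^sup>2) = (LBINT r:{0..}. f t r * (\<psi> r * r\<^sup>2))"
    by (simp add: mult.assoc)
  also have "\<dots> = (\<integral>r. U t r * (\<psi> r * r\<^sup>2) \<partial>lborel)"
    by (rule set_integral_clean[OF f_L1 f_nonneg]) (use assms in auto)
  finally show ?thesis .
qed

section \<open>Collision rate, mass balance and positivity of \<open>nc\<close>\<close>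

definition rate :: "real \<Rightarrow> real" where "rate t = \<kappa> / nc t"

lemma nc_nonneg: "0 \<le> t \<Longrightarrow> 0 \<le> nc t" using sol by (auto simp: solution_def)

lemma rate_nonneg: "0 \<le> t \<Longrightarrow> 0 \<le> rate t" using \<kappa>_pos nc_nonneg by (simp add: rate_def)

lemma f_derivative: "0 < t \<Longrightarrow> has_L1_derivative f (\<lambda>r. rate t * Q (f t) r) t {0..}"
  using sol by (auto simp: solution_def rate_def)

lemma nc_derivative:
  assumes "0 < t"
  shows "(nc has_real_derivative - rate t * moment 2 (Q (f t))) (at t)"
proof -
  have "(nc has_real_derivative - rate t * moment 2 (Q (f t))) (at t within {0..})"
    using sol assms by (auto simp: solution_def rate_def)
  moreover have "at t within {0..} = at t" by (rule at_within_interior) (use assms in simp)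
  ultimately show ?thesis by simp
qed

lemma source_L1: "0 < t \<Longrightarrow> radial_L1 (\<lambda>r. rate t * Q (f t) r)"
  using f_derivative by (auto simp: has_L1_derivative_def)

text \<open>The volume factor r^2 cancels the 1 / r^2 in \<open>Q\<close>. The rate stays attached
  to \<open>Q\<close> because the notion of L^1 derivative provides measurability and integrability
  of the product only.\<close>

lemma integral_source_line:
  assumes t: "0 < t" and [measurable]: "\<psi> \<in> borel_measurable borel"
    and \<psi>: "\<And>r. r \<le> 0 \<Longrightarrow> \<psi> r = 0" "\<And>r. \<bar>\<psi> r\<bar> \<le> C"
  shows "(LBINT r:{0..}. rate t * Q (f t) r * \<psi> r * r\<^sup>2) = rate t * (\<integral>r. profile.collision (U t) r * \<psi> r \<partial>lborel)"
proof -
  interpret profile "U t" using t by (intro U_profile) simp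
  have [measurable]: "(\<lambda>r. indicator {0..} r * (rate t * Q (f t) r)) \<in> borel_measurable borel"
    by (rule profile_measurable) (use source_L1[OF t] in \<open>auto simp: radial_L1_def\<close>)
  have "(LBINT r:{0..}. rate t * Q (f t) r * \<psi> r * r\<^sup>2) = (\<integral>r. rate t * (collision r * \<psi> r) \<partial>lborel)"
    unfolding set_lebesgue_integral_def
  proof (rule integral_cong_AE)
    have "(\<lambda>r. (indicator {0..} r * (rate t * Q (f t) r)) * (\<psi> r * r\<^sup>2)) \<in> borel_measurable borel" by measurable
    then show "(\<lambda>r. indicator {0..} r *\<^sub>R (rate t * Q (f t) r * \<psi> r * r\<^sup>2)) \<in> borel_measurable lborel"
      by (simp add: mult.assoc)
    show "(\<lambda>r. rate t * (collision r * \<psi> r)) \<in> borel_measurable lborel"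
      using borel_measurable_integrable[OF integrable_collision[OF assms(2) \<psi>]] by simp
    have "AE r in lborel. 0 < r \<longrightarrow> Q (f t) r * r\<^sup>2 = collision r"
      by (rule Q_clean[OF f_L1 f_nonneg U_profile]) (use t in auto)
    then show "AE r in lborel. indicator {0..} r *\<^sub>R (rate t * Q (f t) r * \<psi> r * r\<^sup>2) = rate t * (collision r * \<psi> r)"
    proof eventually_elim
      case (elim r)
      show ?case
      proof (cases "0 < r")
        case True
        then have "rate t * Q (f t) r * \<psi> r * r\<^sup>2 = rate t * (Q (f t) r * r\<^sup>2 * \<psi> r)" by simp
        then show ?thesis using True elim by simp
      qed (use \<psi>(1)[of r] in simp)
    qed
  qed
  then show ?thesis by simp
qed

lemma integral_source_R3:
  assumes t: "0 < t" and [measurable]: "\<psi> \<in> borel_measurable borel"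
    and \<psi>: "\<And>r. r \<le> 0 \<Longrightarrow> \<psi> r = 0" "\<And>r. \<bar>\<psi> r\<bar> \<le> C"
  shows "(\<integral>p. rate t * Q (f t) (norm (p::real^3)) * \<psi> (norm p) \<partial>lborel)
    = 4 * pi * (rate t * (\<integral>r. profile.collision (U t) r * \<psi> r \<partial>lborel))"
proof -
  have [measurable]: "(\<lambda>p::real^3. rate t * Q (f t) (norm p)) \<in> borel_measurable lborel"
    using source_L1[OF t] by (auto simp: radial_L1_def)
  have "(\<integral>p. rate t * Q (f t) (norm (p::real^3)) * \<psi> (norm p) \<partial>lborel)
     = 4 * pi * (LBINT r:{0..}. rate t * Q (f t) r * \<psi> r * r\<^sup>2)"
    by (rule integral_norm_R3) measurable
  then show ?thesis using integral_source_line[OF assms] by simp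
qed

lemma
  shows L1_continuity: "0 \<le> t \<Longrightarrow>
      ((\<lambda>s. \<integral>p. \<bar>f s (norm (p::real^3)) - f t (norm p)\<bar> \<partial>lborel) \<longlongrightarrow> 0) (at t within {0..})"
    and L1_differentiability: "0 < t \<Longrightarrow>
      ((\<lambda>s. \<integral>p. \<bar>(f s (norm (p::real^3)) - f t (norm p)) / (s - t) - rate t * Q (f t) (norm p)\<bar> \<partial>lborel) \<longlongrightarrow> 0) (at t within {0..})"
  using sol f_derivative[of t]
  by (auto simp: solution_def L1_continuous_on_def L1_norm_def has_L1_derivative_def)

lemma f_integrable: "0 \<le> t \<Longrightarrow> integrable lborel (\<lambda>p::real^3. f t (norm p))"
  using f_L1 by (auto simp: radial_L1_def)

lemma source_integrable: "0 < t \<Longrightarrow> integrable lborel (\<lambda>p::real^3. rate t * Q (f t) (norm p))"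
  using source_L1 by (auto simp: radial_L1_def)

lemma moment2_R3: "0 \<le> t \<Longrightarrow> moment 2 (f t) = (\<integral>p. f t (norm (p::real^3)) * 1 \<partial>lborel) / (4 * pi)"
  using integral_f_R3[of t "\<lambda>_. 1"] U_moments(1)[of t] by simp

text \<open>Testing with the constant 1, the mass and \<open>nc\<close> change at the same rate
  \<open>rate s * moment 2 (Q (f s))\<close> with opposite signs, whatever its value.\<close>

lemma mass_conservation:
  assumes "0 \<le> t"
  shows "nc t + moment 2 (f t) = n0 + moment 2 f0"
proof (cases "t = 0")
  case True
  then show ?thesis using sol by (simp add: solution_def)
next
  case False
  then have t: "0 < t" using assms by simp
  define m where "m s = (\<integral>p. f s (norm (p::real^3)) * 1 \<partial>lborel) / (4 * pi)" for s
  have cont: "continuous_on {0..} (\<lambda>s. nc s + m s)"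
    unfolding continuous_on_def m_def
  proof (intro ballI tendsto_intros)
    fix s :: real assume s: "s \<in> {0..}"
    show "(nc \<longlongrightarrow> nc s) (at s within {0..})" using sol s by (auto simp: solution_def continuous_on_def)
    show "((\<lambda>s. \<integral>p. f s (norm (p::real^3)) * 1 \<partial>lborel) \<longlongrightarrow> (\<integral>p. f s (norm (p::real^3)) * 1 \<partial>lborel)) (at s within {0..})"
      by (rule integral_product_continuous[where C = 1 and L = 0])
        (use s f_integrable L1_continuity in auto)
  qed simp
  have der: "((\<lambda>s. nc s + m s) has_real_derivative 0) (at s)" if s: "0 < s" for s
  proof -
    have "((\<lambda>s. \<integral>p. f s (norm (p::real^3)) * 1 \<partial>lborel) has_real_derivative
      (\<integral>p. rate s * Q (f s) (norm (p::real^3)) * 1 \<partial>lborel) + (\<integral>p. f s (norm (p::real^3)) * 0 \<partial>lborel)) (at s within {0..})"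
      by (rule integral_product_has_derivative[where C = 1 and L = 0])
        (use s f_integrable source_integrable L1_differentiability in auto)
    moreover have "(\<integral>p. rate s * Q (f s) (norm (p::real^3)) \<partial>lborel) = 4 * pi * (rate s * moment 2 (Q (f s)))"
      using integral_norm_R3[of "\<lambda>r. rate s * Q (f s) r", OF borel_measurable_integrable[OF source_integrable[OF s]]]
      by (simp only: moment_def mult.assoc set_integral_mult_right)
    ultimately have "(m has_real_derivative rate s * moment 2 (Q (f s))) (at s within {0..})"
      unfolding m_def by (auto intro!: derivative_eq_intros)
    moreover have "(nc has_real_derivative - rate s * moment 2 (Q (f s))) (at s within {0..})"
      using nc_derivative[OF s] by (rule has_field_derivative_at_within)
    ultimately have "((\<lambda>s. nc s + m s) has_real_derivative 0) (at s within {0..})"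
      by (auto intro!: derivative_eq_intros)
    moreover have "at s within {0..} = at s" by (rule at_within_interior) (use s in simp)
    ultimately show ?thesis by simp
  qed
  \<comment> \<open>The equations hold at positive times only; continuity carries the conserved
    value to time 0.\<close>
  have "nc t + m t = nc 0 + m 0"
    by (rule DERIV_isconst_end[OF t]) (use der in \<open>auto intro: continuous_on_subset[OF cont]\<close>)
  then show ?thesis using moment2_R3[of t] moment2_R3[of 0] t sol
    by (simp add: m_def solution_def)
qed

text \<open>The bound of \<open>integral_collision_le\<close>, with moments 2, 4 and 7 replaced by
  their bounds uniform in time.\<close>

definition M2 :: real where
  "M2 = 2 * (n0 + moment 2 f0) * (h3 + h8) + (n0 + moment 2 f0 + h8)"

lemma moment2_le: "0 \<le> t \<Longrightarrow> moment 2 (f t) \<le> n0 + moment 2 f0"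
  using mass_conservation[of t] nc_nonneg[of t] by simp

lemma nc_le: "0 \<le> t \<Longrightarrow> nc t \<le> n0 + moment 2 f0"
  using mass_conservation[of t] U_moments(4)[of t] by simp

lemma f_0: "f 0 = f0" using sol by (simp add: solution_def)

lemma moment2_0: "0 \<le> moment 2 f0" using U_moments(4)[of 0] f_0 by simp

lemma M2_pos: "0 < M2"
proof -
  have "0 \<le> h8" using U_moments(5)[of 0] by simp
  then have "0 < n0 + moment 2 f0 + h8" "0 \<le> 2 * (n0 + moment 2 f0) * (h3 + h8)"
    using n0_pos h3_pos moment2_0 by (simp_all add: mult_nonneg_nonneg)
  then show ?thesis unfolding M2_def by linarith
qed

lemma moment2_source_le:
  assumes t: "0 < t" 
  shows "rate t * moment 2 (Q (f t)) \<le> rate t * M2"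
proof -
  interpret profile "U t" using t by (intro U_profile) simp
  have 1: "(LBINT r:{0..}. rate t * Q (f t) r * pos r * r\<^sup>2) = rate t * moment 2 (Q (f t))"
  proof -
    have "(LBINT r:{0..}. rate t * Q (f t) r * pos r * r\<^sup>2) = (LBINT r:{0..}. rate t * (Q (f t) r * r\<^sup>2))"
      by (rule set_lebesgue_integral_cong) (auto simp: indicator_def)
    then show ?thesis by (simp add: moment_def)
  qed
  have 2: "(LBINT r:{0..}. rate t * Q (f t) r * pos r * r\<^sup>2) = rate t * (\<integral>r. collision r * pos r \<partial>lborel)"
    by (rule integral_source_line[OF t, where C = 1]) (auto simp: indicator_def)
  have "(\<integral>r. collision r * pos r \<partial>lborel) \<le> M2"
  proof -
    note m = U_moments[of t] moment2_le[of t]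
    have "moment 2 (f t) * (\<integral>r. U t r * r ^ 4 \<partial>lborel) \<le> (n0 + moment 2 f0) * (h3 + h8)"
      using m t n0_pos moment2_0 by (intro mult_mono) auto
    then show ?thesis using integral_collision_le m t unfolding M2_def by (simp add: algebra_simps)
  qed
  then show ?thesis unfolding trans[OF sym[OF 1] 2] by (rule mult_left_mono) (use rate_nonneg[of t] t in auto)
qed

text \<open>The square of \<open>nc\<close> removes the singular factor 1 / \<open>nc\<close>: it
  decreases at most at speed 2 \<kappa> \<open>M2\<close>, so half of n0^2 is still left at the
  stated time.\<close>

lemma nc_pos:
  assumes t: "0 \<le> t" "t \<le> n0\<^sup>2 / (4 * \<kappa> * M2)"
  shows "0 < nc t"
proof -
  have cont: "continuous_on {0..} nc" using sol by (auto simp: solution_def)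
  have "(nc 0)\<^sup>2 + 2 * \<kappa> * M2 * 0 \<le> (nc t)\<^sup>2 + 2 * \<kappa> * M2 * t"
  proof (rule DERIV_nonneg_imp_increasing_open[OF t(1)])
    show "continuous_on {0..t} (\<lambda>s. (nc s)\<^sup>2 + 2 * \<kappa> * M2 * s)"
      by (intro continuous_intros continuous_on_subset[OF cont]) auto
    fix s assume s: "0 < s" "s < t"
    from nc_derivative[OF s(1)] have "((\<lambda>s. (nc s)\<^sup>2 + 2 * \<kappa> * M2 * s) has_real_derivative
        2 * \<kappa> * M2 - 2 * nc s * (rate s * moment 2 (Q (f s)))) (at s)"
      by (auto intro!: derivative_eq_intros)
    moreover have "nc s * (rate s * moment 2 (Q (f s))) \<le> \<kappa> * M2"
    proof -
      have "nc s * (rate s * moment 2 (Q (f s))) \<le> nc s * (rate s * M2)"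
        by (rule mult_left_mono[OF moment2_source_le nc_nonneg]) (use s in auto)
      \<comment> \<open>Equality where \<open>nc s\<close> is positive; where it is zero the left
        side is zero.\<close>
      also have "\<dots> \<le> \<kappa> * M2" using \<kappa>_pos M2_pos by (simp add: rate_def)
      finally show ?thesis .
    qed
    ultimately show "\<exists>y. ((\<lambda>s. (nc s)\<^sup>2 + 2 * \<kappa> * M2 * s) has_real_derivative y) (at s) \<and> 0 \<le> y"
      by (intro exI conjI) auto
  qed
  moreover have "2 * \<kappa> * M2 * t \<le> n0\<^sup>2 / 2"
    using mult_left_mono[OF t(2), of "2 * \<kappa> * M2"] \<kappa>_pos M2_pos by simp
  moreover have "nc 0 = n0" using sol by (simp add: solution_def)
  then have "(nc 0)\<^sup>2 = n0\<^sup>2" by simp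
  moreover have "0 < n0\<^sup>2" using n0_pos by simp
  ultimately have "0 < (nc t)\<^sup>2" by linarith
  then show ?thesis using nc_nonneg[OF t(1)] by (cases "nc t = 0") auto
qed

text \<open>The subtracted linear part integrates to a factor times the third moment, which is
  \<open>h3\<close> at all times. The bounded test function therefore recovers the exponential
  moments up to explicit functions of \<theta>.\<close>

lemma cut_test_line:
  assumes t: "0 \<le> t" and \<theta>: "0 \<le> \<theta>" and N: "0 < N"
  shows "(\<integral>p. f t (norm (p::real^3)) * cut_test \<theta> N (norm p) \<partial>lborel)
      = 4 * pi * (profile.E3 (U t) \<theta> N - exp (\<theta> * N) * h3)"
    and "(\<integral>p. f t (norm (p::real^3)) * cut_test' \<theta> N (norm p) \<partial>lborel)
      = 4 * pi * (profile.E4 (U t) \<theta> N - N * exp (\<theta> * N) * h3)"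
proof -
  interpret profile "U t" using t by (rule U_profile)
  note I = E_integrable[OF \<theta> N] integrable_power[of 3]
  have 1: "U t r * (cut_test \<theta> N r * r\<^sup>2) = U t r * (r ^ 3 * gexp \<theta> N r) - exp (\<theta> * N) * (U t r * r ^ 3)" for r
    by (cases "0 < r") (auto simp: cut_test_def u_zero power_numeral_reduce algebra_simps)
  have 2: "U t r * (cut_test' \<theta> N r * r\<^sup>2) = U t r * (r ^ 3 * min r N * gexp \<theta> N r) - N * exp (\<theta> * N) * (U t r * r ^ 3)" for r
    by (cases "0 < r") (auto simp: cut_test'_def u_zero power_numeral_reduce algebra_simps)
  show "(\<integral>p. f t (norm (p::real^3)) * cut_test \<theta> N (norm p) \<partial>lborel)
      = 4 * pi * (E3 \<theta> N - exp (\<theta> * N) * h3)"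
    unfolding integral_f_R3[OF t cut_test_measurable] 1 using I U_moments(2)[OF t] by (simp add: E3_def)
  show "(\<integral>p. f t (norm (p::real^3)) * cut_test' \<theta> N (norm p) \<partial>lborel)
      = 4 * pi * (E4 \<theta> N - N * exp (\<theta> * N) * h3)"
    unfolding integral_f_R3[OF t cut_test'_measurable] 2 using I U_moments(2)[OF t] by (simp add: E4_def)
qed

context
  fixes a b \<theta>0 \<mu> N :: real
  assumes a: "0 \<le> a" and \<theta>_range: "\<And>s. s \<in> {a..b} \<Longrightarrow> 0 \<le> \<theta>0 + \<mu> * s \<and> \<theta>0 + \<mu> * s \<le> 1"
    and N: "0 < N" and \<mu>: "0 \<le> \<mu>"
begin

definition \<Theta> :: "real \<Rightarrow> real" where "\<Theta> s = \<theta>0 + \<mu> * s"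

definition G :: "real \<Rightarrow> real" where "G s = profile.E3 (U s) (\<Theta> s) N"

definition W :: "real \<Rightarrow> real" where
  "W s = (\<integral>p. f s (norm (p::real^3)) * cut_test (\<Theta> s) N (norm p) \<partial>lborel)"

lemma \<Theta>: "s \<in> {a..b} \<Longrightarrow> 0 \<le> \<Theta> s" "s \<in> {a..b} \<Longrightarrow> \<Theta> s \<le> 1" "\<Theta> s - \<Theta> t = \<mu> * (s - t)"
  using \<theta>_range by (simp_all add: \<Theta>_def right_diff_distrib)

lemma G_eq: "s \<in> {a..b} \<Longrightarrow> G s = W s / (4 * pi) + exp (\<Theta> s * N) * h3"
  using cut_test_line(1)[of s "\<Theta> s" N] \<Theta>(1)[of s] a N by (simp add: G_def W_def)

lemma cut_bound: "s \<in> {a..b} \<Longrightarrow> \<bar>cut_test (\<Theta> s) N r\<bar> \<le> N * exp N"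
  using cut_test_bound[of "\<Theta> s" N r] \<Theta>(1,2)[of s] N
  by (auto intro: order_trans)

lemma cut_lip:
  "s \<in> {a..b} \<Longrightarrow> t \<in> {a..b} \<Longrightarrow> \<bar>cut_test (\<Theta> s) N r - cut_test (\<Theta> t) N r\<bar> \<le> (2 * N * N * exp N * \<mu>) * \<bar>s - t\<bar>"
  using cut_test_estimates(1)[of "\<Theta> s" "\<Theta> t" N r] \<Theta>[of s] \<Theta>[of t] N \<mu> by (simp add: abs_mult mult.assoc)

lemma G_continuous: "continuous_on {a..b} G"
proof -
  have "continuous_on {a..b} W"
    unfolding continuous_on_def W_def
  proof
    fix t assume t: "t \<in> {a..b}"
    show "((\<lambda>s. \<integral>p. f s (norm (p::real^3)) * cut_test (\<Theta> s) N (norm p) \<partial>lborel) \<longlongrightarrow>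
       (\<integral>p. f t (norm (p::real^3)) * cut_test (\<Theta> t) N (norm p) \<partial>lborel)) (at t within {a..b})"
      by (rule integral_product_continuous[where C = "N * exp N" and L = "2 * N * N * exp N * \<mu>"])
        (use t a f_integrable cut_bound cut_lip in
          \<open>auto intro: tendsto_within_subset[OF L1_continuity]\<close>)
  qed
  then have "continuous_on {a..b} (\<lambda>s. W s / (4 * pi) + exp (\<Theta> s * N) * h3)"
    unfolding \<Theta>_def by (intro continuous_intros) auto
  then show ?thesis by (rule continuous_on_cong[THEN iffD1, rotated -1]) (auto simp: G_eq)
qed

text \<open>Differentiating the restored term exp(\<Theta> N) h3 compensates exactly the part
  subtracted in \<open>cut_test'\<close>, so the exponent contributes \<mu> E4 and no trace of the
  cut-off correction remains.\<close>

lemma G_derivative: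
  assumes t: "a < t" "t < b"
  shows "(G has_real_derivative
     rate t * (\<integral>r. profile.collision (U t) r * cut_test (\<Theta> t) N r \<partial>lborel) + \<mu> * profile.E4 (U t) (\<Theta> t) N) (at t)"
proof -
  have tab: "t \<in> {a..b}" "0 < t" using t a by auto
  \<comment> \<open>One constant has to serve as Lipschitz bound, as Taylor bound (quadratic in
    \<mu>) and as bound on the derivative of the test function.\<close>
  let ?L = "2 * N * N * exp N * \<mu> + 2 * N * N\<^sup>2 * exp N * \<mu>\<^sup>2"
  have L: "2 * N * N * exp N * \<mu> \<le> ?L" "2 * N * N\<^sup>2 * exp N * \<mu>\<^sup>2 \<le> ?L" using N \<mu> by auto
  have W: "(W has_real_derivative
     (\<integral>p. rate t * Q (f t) (norm (p::real^3)) * cut_test (\<Theta> t) N (norm p) \<partial>lborel)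
     + (\<integral>p. f t (norm (p::real^3)) * (\<mu> * cut_test' (\<Theta> t) N (norm p)) \<partial>lborel)) (at t within {a..b})"
    unfolding W_def
  proof (rule integral_product_has_derivative[where C = "N * exp N" and L = ?L])
    show "((\<lambda>s. \<integral>p. \<bar>(f s (norm (p::real^3)) - f t (norm p)) / (s - t) - rate t * Q (f t) (norm p)\<bar> \<partial>lborel) \<longlongrightarrow> 0) (at t within {a..b})"
      by (rule tendsto_within_subset[OF L1_differentiability]) (use tab a in auto)
    fix s and p :: "real^3" assume s: "s \<in> {a..b}"
    show "\<bar>cut_test (\<Theta> s) N (norm p) - cut_test (\<Theta> t) N (norm p)\<bar> \<le> ?L * \<bar>s - t\<bar>"
      using cut_lip[OF s tab(1)] mult_right_mono[OF L(1), of "\<bar>s - t\<bar>"] by (meson abs_ge_zero order_trans)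
    have "\<bar>cut_test (\<Theta> s) N (norm p) - cut_test (\<Theta> t) N (norm p) - (s - t) * (\<mu> * cut_test' (\<Theta> t) N (norm p))\<bar>
        \<le> (2 * N * N\<^sup>2 * exp N * \<mu>\<^sup>2) * (s - t)\<^sup>2"
      using cut_test_estimates(2)[of "\<Theta> s" "\<Theta> t" N "norm p"] \<Theta>[of s] \<Theta>[of t] N s tab
      by (simp add: power_mult_distrib mult_ac)
    then show "\<bar>cut_test (\<Theta> s) N (norm p) - cut_test (\<Theta> t) N (norm p) - (s - t) * (\<mu> * cut_test' (\<Theta> t) N (norm p))\<bar>
        \<le> ?L * (s - t)\<^sup>2"
      using mult_right_mono[OF L(2), of "(s - t)\<^sup>2"] by (meson zero_le_power2 order_trans)
  next
    fix p :: "real^3"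
    have "\<bar>\<mu> * cut_test' (\<Theta> t) N (norm p)\<bar> \<le> \<mu> * (2 * N * N * exp N)"
      using cut_test_estimates(3)[of "\<Theta> t" "\<Theta> t" N "norm p"] \<Theta>[of t] N tab \<mu>
      by (auto simp: abs_mult intro!: mult_left_mono)
    then show "\<bar>\<mu> * cut_test' (\<Theta> t) N (norm p)\<bar> \<le> ?L" using L(1) by (simp add: mult_ac)
  qed (use tab a f_integrable source_integrable cut_bound in auto)
  have e1: "(\<integral>p. rate t * Q (f t) (norm (p::real^3)) * cut_test (\<Theta> t) N (norm p) \<partial>lborel)
     = 4 * pi * (rate t * (\<integral>r. profile.collision (U t) r * cut_test (\<Theta> t) N r \<partial>lborel))"
    by (rule integral_source_R3[OF tab(2) cut_test_measurable _ cut_bound[OF tab(1)]]) (simp add: cut_test_def)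
  have e2: "(\<integral>p. f t (norm (p::real^3)) * (\<mu> * cut_test' (\<Theta> t) N (norm p)) \<partial>lborel)
     = \<mu> * (4 * pi * (profile.E4 (U t) (\<Theta> t) N - N * exp (\<Theta> t * N) * h3))"
    using cut_test_line(2)[of t "\<Theta> t" N] \<Theta>(1)[OF tab(1)] tab N by (simp add: mult.left_commute)
  define C where "C = (\<integral>r. profile.collision (U t) r * cut_test (\<Theta> t) N r \<partial>lborel)"
  define E where "E = profile.E4 (U t) (\<Theta> t) N"
  have "(W has_real_derivative 4 * pi * (rate t * C) + \<mu> * (4 * pi * (E - N * exp (\<Theta> t * N) * h3))) (at t within {a..b})"
    using W unfolding e1 e2 C_def E_def .
  moreover have "at t within {a..b} = at t" by (rule at_within_interior) (use t in simp)
  ultimately have W': "(W has_real_derivative 4 * pi * (rate t * C) + \<mu> * (4 * pi * (E - N * exp (\<Theta> t * N) * h3))) (at t)"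
    by simp
  have "((\<lambda>s. exp (\<Theta> s * N) * h3) has_real_derivative \<mu> * N * exp (\<Theta> t * N) * h3) (at t)"
    unfolding \<Theta>_def by (auto intro!: derivative_eq_intros)
  from DERIV_add[OF DERIV_cdivide[OF W', of "4 * pi"] this]
  have "((\<lambda>s. W s / (4 * pi) + exp (\<Theta> s * N) * h3) has_real_derivative rate t * C + \<mu> * E) (at t)"
    by (rule DERIV_cong) (simp add: divide_simps, simp add: algebra_simps)
  then have "((\<lambda>s. W s / (4 * pi) + exp (\<Theta> s * N) * h3) has_real_derivative
     rate t * (\<integral>r. profile.collision (U t) r * cut_test (\<Theta> t) N r \<partial>lborel) + \<mu> * profile.E4 (U t) (\<Theta> t) N) (at t)"
    unfolding C_def E_def .
  then show ?thesis
    by (rule has_field_derivative_transform_within_open[where S = "{a<..<b}"]) (use t in \<open>auto simp: G_eq\<close>)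
qed

text \<open>Bookkeeping in units of 1 / 12288, one quarter of 1 / 3072: the loss supplies -4 E8 + 12
  h8, the gain costs at most G + E8 because 98304 = 8 * 12288, and the growth of the exponent costs
  at most one further E8 plus the term 3 \<mu> (h3 + h8), which is kept. The balance is G - 2 E8 +
  12 h8.\<close>

lemma G_derivative_le:
  assumes t: "a < t" "t < b" and B: "6 * h3 + 12 * h8 \<le> G t" "G t \<le> B" "98304 * \<Theta> t * B \<le> 1"
    and \<beta>: "0 \<le> \<beta>" "\<mu> * \<Theta> t ^ 4 \<le> \<beta>" "12288 * \<beta> \<le> rate t" and N1: "1 \<le> N"
  shows "rate t * (\<integral>r. profile.collision (U t) r * cut_test (\<Theta> t) N r \<partial>lborel) + \<mu> * profile.E4 (U t) (\<Theta> t) N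
     \<le> 3 * \<mu> * (h3 + h8)"
proof -
  have tab: "t \<in> {a..b}" "0 \<le> t" using t a by auto
  interpret profile "U t" by (rule U_profile[OF tab(2)])
  note \<theta> = \<Theta>(1,2)[OF tab(1)] and m = U_moments[OF tab(2)]
  define E8t where "E8t = E8 (\<Theta> t) N"
  have E8t: "0 \<le> E8t" unfolding E8t_def E8_def
    by (rule Bochner_Integration.integral_nonneg) (auto simp: u_nonneg less_imp_le[OF gexp_pos])
  have E5: "E5 (\<Theta> t) N \<le> G t + E8t" unfolding G_def E8t_def by (rule E5_le[OF \<theta>(1) N1])
  have E5_0: "0 \<le> E5 (\<Theta> t) N" unfolding E5_def
  proof (rule Bochner_Integration.integral_nonneg)
    show "0 \<le> U t r * (r ^ 4 * min r N * gexp (\<Theta> t) N r)" for r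
      using N u_zero[of r] u_nonneg[of r] less_imp_le[OF gexp_pos] by (cases "0 < r") auto
  qed
  have E3: "G t \<le> E8t + 3 * h3" using E3_le[OF \<theta> N1] m(2) unfolding G_def E8t_def by simp
  have E4: "\<mu> * E4 (\<Theta> t) N \<le> \<beta> * E8t + 3 * \<mu> * (h3 + h8)"
    using E4_le[OF \<theta>(1) N1 \<mu> \<beta>(1,2)] mult_left_mono[OF m(6), of "3 * \<mu>"] \<mu> unfolding E8t_def by simp
  have "8 * \<Theta> t * G t * E5 (\<Theta> t) N \<le> 1 / 12288 * (G t + E8t)"
  proof -
    have "98304 * \<Theta> t * G t \<le> 98304 * \<Theta> t * B" using \<theta>(1) B(2) by (intro mult_left_mono) auto
    then have "8 * \<Theta> t * G t \<le> 1 / 12288" using B(3) by simp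
    then show ?thesis using E5 E5_0 by (intro mult_mono) auto
  qed
  then have "(\<integral>r. collision r * cut_test (\<Theta> t) N r \<partial>lborel) \<le> (G t - 3 * E8t + 12 * h8) / 12288"
    using collision_cut_test_le[OF \<theta>(1) N] m(3) unfolding G_def[symmetric] E8t_def[symmetric] by (simp add: field_simps)
  then have "rate t * (\<integral>r. collision r * cut_test (\<Theta> t) N r \<partial>lborel) \<le> rate t * ((G t - 3 * E8t + 12 * h8) / 12288)"
    by (rule mult_left_mono) (rule rate_nonneg[OF tab(2)])
  moreover have "\<beta> * E8t \<le> rate t / 12288 * E8t"
    using \<beta>(3) E8t by (intro mult_right_mono) auto
  ultimately have "rate t * (\<integral>r. collision r * cut_test (\<Theta> t) N r \<partial>lborel) + \<mu> * E4 (\<Theta> t) N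
     \<le> 3 * \<mu> * (h3 + h8) + rate t * ((G t - 2 * E8t + 12 * h8) / 12288)"
    using E4 by (simp add: add_divide_distrib diff_divide_distrib distrib_left right_diff_distrib)
  \<comment> \<open>From E8 >= G - 3 h3 the bracket is at most 6 h3 + 12 h8 - G, which explains the
    lower barrier level.\<close>
  moreover have "rate t * ((G t - 2 * E8t + 12 * h8) / 12288) \<le> 0"
    using rate_nonneg[OF tab(2)] B(1) E3 by (intro mult_nonneg_nonpos) auto
  ultimately show ?thesis by linarith
qed

end

end

text \<open>The time of \<open>nc_pos\<close> with \<open>M2\<close> written out in the data; the
  cap 1 keeps fifth roots of admissible times below 1.\<close>

definition nc_life :: "real \<Rightarrow> real \<Rightarrow> real \<Rightarrow> real \<Rightarrow> real \<Rightarrow> real" where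
  "nc_life \<kappa> h8 m2 h3 n0 = min 1 (n0\<^sup>2 / (4 * \<kappa> * (2 * (n0 + m2) * (h3 + h8) + (n0 + m2 + h8))))"

text \<open>Barrier level 6 h3 + 12 h8, plus the possible rise 3 h3 + 3 h8 during the growth phase,
  plus 1 for the strict inequality that \<open>barrier\<close> requires.\<close>

definition exp_bound :: "real \<Rightarrow> real \<Rightarrow> real" where
  "exp_bound h8 h3 = 9 * h3 + 15 * h8 + 1"

text \<open>The three entries ensure \<theta> <= 1, a small gain (98304 \<theta>
  \<open>exp_bound\<close> <= 1), and 12288 \<open>slope\<close> below the least possible rate
  \<kappa> / (n0 + m2), where n0 + m2 is the conserved total mass.\<close>

definition slope :: "real \<Rightarrow> real \<Rightarrow> real \<Rightarrow> real \<Rightarrow> real \<Rightarrow> real" where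
  "slope \<kappa> h8 m2 h3 n0 = min 1 (min (1 / (98304 * exp_bound h8 h3)) (\<kappa> / (12288 * (n0 + m2))))"

text \<open>The first entry is the exponent reached at the end of the growth phase. The second turns
  the uniform bound 4 pi \<open>exp_bound\<close> into the required 1 / (2 a).\<close>

definition exp_rate :: "real \<Rightarrow> real \<Rightarrow> real \<Rightarrow> real \<Rightarrow> real \<Rightarrow> real" where
  "exp_rate \<kappa> h8 m2 h3 n0 =
     min (slope \<kappa> h8 m2 h3 n0 * nc_life \<kappa> h8 m2 h3 n0 powr (1 / 5)) (1 / (8 * pi * exp_bound h8 h3))"

section \<open>Generation and propagation of exponential moments\<close>

context kinetic
begin

lemma E3_barrier:
  assumes ab: "0 \<le> a" "a \<le> b" and range: "\<And>s. s \<in> {a..b} \<Longrightarrow> 0 \<le> \<theta>0 + \<mu> * s \<and> \<theta>0 + \<mu> * s \<le> 1"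
    and N: "1 \<le> N" and \<mu>: "0 \<le> \<mu>" and \<beta>: "0 \<le> \<beta>"
    and small: "\<And>s. a < s \<Longrightarrow> s < b \<Longrightarrow> 98304 * (\<theta>0 + \<mu> * s) * B \<le> 1"
      "\<And>s. a < s \<Longrightarrow> s < b \<Longrightarrow> \<mu> * (\<theta>0 + \<mu> * s) ^ 4 \<le> \<beta>"
      "\<And>s. a < s \<Longrightarrow> s < b \<Longrightarrow> 12288 * \<beta> \<le> rate s"
    and start: "profile.E3 (U a) (\<theta>0 + \<mu> * a) N \<le> B0" and B0: "6 * h3 + 12 * h8 \<le> B0"
    and B: "B0 + 3 * \<mu> * (h3 + h8) * (b - a) < B"
  shows "profile.E3 (U b) (\<theta>0 + \<mu> * b) N \<le> B0 + 3 * \<mu> * (h3 + h8) * (b - a)"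
proof -
  have N0: "0 < N" using N by simp
  note ctx = ab(1) range N0 \<mu>
  have \<Theta>: "\<Theta> \<theta>0 \<mu> s = \<theta>0 + \<mu> * s" for s by (rule \<Theta>_def[OF ctx])
  have G: "G \<theta>0 \<mu> N s = profile.E3 (U s) (\<theta>0 + \<mu> * s) N" for s
    unfolding \<Theta>[symmetric] by (rule G_def[OF ctx])
  have "0 \<le> h8" using U_moments(5)[of 0] by simp
  have "G \<theta>0 \<mu> N b \<le> B0 + 3 * \<mu> * (h3 + h8) * (b - a)"
  proof (rule barrier[where a = a and b = b and G = "G \<theta>0 \<mu> N" and t = b and B = B and G' = "\<lambda>t. rate t * (\<integral>r. profile.collision (U t) r * cut_test (\<Theta> \<theta>0 \<mu> t) N r \<partial>lborel)
        + \<mu> * profile.E4 (U t) (\<Theta> \<theta>0 \<mu> t) N"])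
    show "continuous_on {a..b} (G \<theta>0 \<mu> N)" by (rule G_continuous[OF ctx])
    show "(G \<theta>0 \<mu> N has_real_derivative rate t * (\<integral>r. profile.collision (U t) r * cut_test (\<Theta> \<theta>0 \<mu> t) N r \<partial>lborel)
        + \<mu> * profile.E4 (U t) (\<Theta> \<theta>0 \<mu> t) N) (at t)" if "a < t" "t < b" for t
      by (rule G_derivative[OF ctx that])
    show "rate t * (\<integral>r. profile.collision (U t) r * cut_test (\<Theta> \<theta>0 \<mu> t) N r \<partial>lborel)
        + \<mu> * profile.E4 (U t) (\<Theta> \<theta>0 \<mu> t) N \<le> 3 * \<mu> * (h3 + h8)"
      if t: "a < t" "t < b" "B0 \<le> G \<theta>0 \<mu> N t" "G \<theta>0 \<mu> N t \<le> B" for t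
      by (rule G_derivative_le[OF ctx t(1,2) order_trans[OF B0 t(3)] t(4)])
        (use small[OF t(1,2)] \<beta> N in \<open>simp_all only: \<Theta>\<close>)
    show "0 \<le> 3 * \<mu> * (h3 + h8)" using \<mu> h3_pos \<open>0 \<le> h8\<close> by simp
    show "G \<theta>0 \<mu> N a \<le> B0" using start by (simp only: G)
  qed (use B ab in auto)
  then show ?thesis by (simp only: G)
qed

abbreviation T0 :: real where "T0 \<equiv> nc_life \<kappa> h8 (moment 2 f0) h3 n0"
abbreviation A0 :: real where "A0 \<equiv> slope \<kappa> h8 (moment 2 f0) h3 n0"

lemma h8_nonneg: "0 \<le> h8" using U_moments(5)[of 0] by simp

lemma constants:
  shows "0 < T0" "T0 \<le> 1" "T0 \<le> n0\<^sup>2 / (4 * \<kappa> * M2)"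
    "0 < A0" "A0 \<le> 1" "98304 * A0 * exp_bound h8 h3 \<le> 1" "12288 * A0 \<le> \<kappa> / (n0 + moment 2 f0)"
    "0 < exp_bound h8 h3"
proof -
  have T0: "T0 = min 1 (n0\<^sup>2 / (4 * \<kappa> * M2))" by (simp add: nc_life_def M2_def)
  have m: "0 < n0 + moment 2 f0" using n0_pos moment2_0 by simp
  show B: "0 < exp_bound h8 h3" using h3_pos h8_nonneg by (simp add: exp_bound_def)
  show "0 < T0" "T0 \<le> 1" "T0 \<le> n0\<^sup>2 / (4 * \<kappa> * M2)"
    using M2_pos \<kappa>_pos n0_pos by (auto simp: T0)
  show "0 < A0" "A0 \<le> 1" using B m \<kappa>_pos by (auto simp: slope_def)
  have "A0 \<le> 1 / (98304 * exp_bound h8 h3)" "A0 \<le> \<kappa> / (12288 * (n0 + moment 2 f0))"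
    by (auto simp: slope_def)
  with B m show "98304 * A0 * exp_bound h8 h3 \<le> 1" "12288 * A0 \<le> \<kappa> / (n0 + moment 2 f0)"
    by (simp_all add: pos_le_divide_eq algebra_simps)
qed

lemma rate_ge:
  assumes "0 \<le> t" "t \<le> T0"
  shows "12288 * A0 \<le> rate t"
proof -
  have "0 < nc t" using nc_pos[OF assms(1)] assms(2) constants(3) by simp
  then have "\<kappa> / (n0 + moment 2 f0) \<le> rate t"
    unfolding rate_def using nc_le[OF assms(1)] \<kappa>_pos by (intro divide_left_mono) auto
  with constants(7) show ?thesis by simp
qed

text \<open>For a given final time the exponent is taken linear in time, which avoids the singular derivative
  of \<open>t powr (1 / 5)\<close> at 0.\<close>

lemma E3_generation:
  assumes t: "0 < t" "t \<le> T0" and N: "1 \<le> N"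
  shows "profile.E3 (U t) (A0 * t powr (1 / 5)) N \<le> 9 * h3 + 15 * h8"
proof -
  define e where "e = A0 * t powr (1 / 5)"
  define \<mu> where "\<mu> = e / t"
  have t1: "t powr (1 / 5) \<le> 1" using powr_mono2[of "1/5" t 1] t constants(2) by simp
  have e: "0 \<le> e" "e \<le> A0" using constants(4) t1 by (auto simp: e_def intro: mult_left_le)
  have \<mu>: "0 \<le> \<mu>" "\<mu> * t = e" using e t by (auto simp: \<mu>_def)
  have \<mu>s: "0 \<le> \<mu> * s" "\<mu> * s \<le> e" if "s \<in> {0..t}" for s
    using that \<mu> mult_left_mono[of s t \<mu>] by auto
  have "(t powr (1 / 5)) ^ 5 = t" using t by (simp add: powr_power)
  then have e5: "e ^ 5 = A0 ^ 5 * t" by (simp add: e_def power_mult_distrib)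
  have A5: "A0 ^ 5 \<le> A0" using constants(4,5) power_decreasing[of 1 5 A0] by simp
  have "profile.E3 (U t) (0 + \<mu> * t) N \<le> (6 * h3 + 12 * h8) + 3 * \<mu> * (h3 + h8) * (t - 0)"
  proof (rule E3_barrier[where \<beta> = A0 and B = "exp_bound h8 h3"])
    interpret profile "U 0" by (rule U_profile) simp
    \<comment> \<open>The exponent is 0 at the start, so E3 is just the third moment.\<close>
    show "E3 (0 + \<mu> * 0) N \<le> 6 * h3 + 12 * h8"
      using U_moments(2)[of 0] h3_pos h8_nonneg by (simp add: E3_def gexp_def)
    \<comment> \<open>Although \<mu> is large for small t, only its time integral \<mu> t = e <= 1
      enters the rise.\<close>
    have "3 * \<mu> * (h3 + h8) * (t - 0) = 3 * (\<mu> * t) * (h3 + h8)" by simp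
    also have "\<dots> \<le> 3 * 1 * (h3 + h8)"
      unfolding \<mu>(2) using e constants(5) h3_pos h8_nonneg by (intro mult_right_mono) auto
    finally show "6 * h3 + 12 * h8 + 3 * \<mu> * (h3 + h8) * (t - 0) < exp_bound h8 h3"
      by (simp add: exp_bound_def)
    fix s :: real
    show "0 \<le> 0 + \<mu> * s \<and> 0 + \<mu> * s \<le> 1" if "s \<in> {0..t}"
      using \<mu>s[OF that] e constants(5) by simp
    assume s: "0 < s" "s < t"
    then have s': "s \<in> {0..t}" by simp
    have "98304 * (\<mu> * s) * exp_bound h8 h3 \<le> 98304 * A0 * exp_bound h8 h3"
      using \<mu>s[OF s'] e constants(8) by (intro mult_right_mono) auto
    then show "98304 * (0 + \<mu> * s) * exp_bound h8 h3 \<le> 1" using constants(6) by simp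
    \<comment> \<open>Here the power 1/5 is decisive: slope e / t times e^4 is e^5 / t, which the
      choice of e makes independent of t.\<close>
    have "\<mu> * (\<mu> * s) ^ 4 \<le> \<mu> * e ^ 4" using \<mu>s[OF s'] \<mu> by (intro mult_left_mono power_mono) auto
    also have "\<dots> = e ^ 5 / t" by (simp add: \<mu>_def power_numeral_reduce)
    also have "\<dots> = A0 ^ 5" using t by (simp add: e5)
    finally show "\<mu> * (0 + \<mu> * s) ^ 4 \<le> A0" using A5 by simp
    show "12288 * A0 \<le> rate s" using rate_ge[of s] s t by simp
  qed (use t N \<mu> constants(4) in auto)
  also have "3 * \<mu> * (h3 + h8) * (t - 0) \<le> 3 * h3 + 3 * h8"
  proof -
    have "3 * \<mu> * (h3 + h8) * (t - 0) = 3 * (\<mu> * t) * (h3 + h8)" by simp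
    also have "\<dots> \<le> 3 * 1 * (h3 + h8)"
      unfolding \<mu>(2) using e constants(5) h3_pos h8_nonneg by (intro mult_right_mono) auto
    finally show ?thesis by simp
  qed
  finally show ?thesis using \<mu>(2) by (simp add: e_def)
qed

text \<open>With \<mu> = 0 the barrier permits no rise at all, so the level 9 h3 + 15 h8 reached at
  \<open>T0\<close> persists over any time span. The choice \<beta> = 0 asks of the rate only that
  it be nonnegative.\<close>

lemma E3_uniform:
  assumes t: "0 < t" and N: "1 \<le> N"
  shows "profile.E3 (U t) (A0 * min t T0 powr (1 / 5)) N \<le> exp_bound h8 h3"
proof (cases "t \<le> T0")
  case True
  then show ?thesis using E3_generation[OF t True N] by (simp add: exp_bound_def)
next
  case False
  define e where "e = A0 * T0 powr (1 / 5)"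
  have t1: "T0 powr (1 / 5) \<le> 1" using powr_mono2[of "1/5" T0 1] constants(1,2) by simp
  have e: "0 \<le> e" "e \<le> A0" using constants(4) t1 by (auto simp: e_def intro: mult_left_le)
  have "profile.E3 (U t) (e + 0 * t) N \<le> 9 * h3 + 15 * h8 + 3 * 0 * (h3 + h8) * (t - T0)"
  proof (rule E3_barrier[where \<beta> = 0 and B = "exp_bound h8 h3"])
    show "profile.E3 (U T0) (e + 0 * T0) N \<le> 9 * h3 + 15 * h8"
      using E3_generation[of T0 N] constants(1) N by (simp add: e_def)
    fix s :: real
    have "98304 * e * exp_bound h8 h3 \<le> 98304 * A0 * exp_bound h8 h3"
      using e constants(8) by (intro mult_right_mono) auto
    then show "98304 * (e + 0 * s) * exp_bound h8 h3 \<le> 1" using constants(6) by simp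
    show "12288 * 0 \<le> rate s" if "T0 < s" "s < t" using rate_nonneg[of s] that constants(1) by simp
  qed (use False N e constants(1,5) h3_pos h8_nonneg in \<open>auto simp: exp_bound_def\<close>)
  then show ?thesis using False by (simp add: e_def exp_bound_def)
qed

lemma exp_moment:
  assumes t: "0 < t"
  defines "a \<equiv> exp_rate \<kappa> h8 (moment 2 f0) h3 n0"
  shows "0 < a"
    and "(\<integral>\<^sup>+p. ennreal (f t (norm p) * norm p * exp (a * min 1 (t powr (1/5)) * norm p)) \<partial>(lborel :: (real^3) measure))
       \<le> ennreal (1 / (2 * a))"
proof -
  have a: "a \<le> A0 * T0 powr (1 / 5)" "a \<le> 1 / (8 * pi * exp_bound h8 h3)"
    by (auto simp: a_def exp_rate_def)
  show a0: "0 < a" using constants(1,4,8) by (auto simp: a_def exp_rate_def)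
  define \<theta> where "\<theta> = A0 * min t T0 powr (1 / 5)"
  have \<theta>0: "0 \<le> \<theta>" using constants(4) by (simp add: \<theta>_def)
  have T1: "T0 powr (1 / 5) \<le> 1" using powr_mono2[of "1/5" T0 1] constants(1,2) by simp
  \<comment> \<open>The attained exponent saturates at \<open>T0\<close> <= 1, the claimed one at
    time 1; the factor \<open>T0 powr (1 / 5)\<close> makes the latter the smaller at every
    time.\<close>
  have "T0 powr (1 / 5) * min 1 (t powr (1/5)) \<le> min t T0 powr (1 / 5)"
  proof (cases "t \<le> T0")
    case True
    then show ?thesis using mult_mono[OF T1, of "min 1 (t powr (1/5))" "t powr (1/5)"] by simp
  next
    case False
    then show ?thesis by (simp add: mult_left_le)
  qed
  then have "A0 * (T0 powr (1 / 5) * min 1 (t powr (1/5))) \<le> \<theta>"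
    unfolding \<theta>_def using constants(4) by (intro mult_left_mono) auto
  moreover have "a * min 1 (t powr (1/5)) \<le> A0 * T0 powr (1 / 5) * min 1 (t powr (1/5))"
    using a(1) by (intro mult_right_mono) auto
  ultimately have a\<theta>: "a * min 1 (t powr (1/5)) \<le> \<theta>" by (simp add: mult.assoc)
  have t0: "0 \<le> t" using t by simp
  interpret profile "U t" by (rule U_profile[OF t0])
  define h where "h r = ennreal (4 * pi * (U t r * (r ^ 3 * exp (\<theta> * r))))" for r
  define hn where "hn n r = ennreal (4 * pi * (U t r * (r ^ 3 * gexp \<theta> (real (Suc n)) r)))" for n r
  have "(\<integral>\<^sup>+p. ennreal (f t (norm p) * norm p * exp (a * min 1 (t powr (1/5)) * norm p)) \<partial>(lborel :: (real^3) measure))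
     \<le> (\<integral>\<^sup>+p. ennreal (U t (norm p) * norm p * exp (\<theta> * norm p)) \<partial>(lborel :: (real^3) measure))"
  proof (rule nn_integral_mono)
    \<comment> \<open>Cleaning only replaces negative values by 0, so this holds at every p; at the
      origin the factor \<open>norm p\<close> makes both sides zero.\<close>
    fix p :: "real^3"
    have "f t (norm p) * norm p * exp (a * min 1 (t powr (1/5)) * norm p)
        \<le> U t (norm p) * norm p * exp (a * min 1 (t powr (1/5)) * norm p)"
      by (cases "p = 0") (auto simp: clean_def intro!: mult_right_mono)
    also have "\<dots> \<le> U t (norm p) * norm p * exp (\<theta> * norm p)"
      using a\<theta> u_nonneg[of "norm p"] by (intro mult_left_mono) (auto intro: mult_right_mono)
    finally show "ennreal (f t (norm p) * norm p * exp (a * min 1 (t powr (1/5)) * norm p))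
        \<le> ennreal (U t (norm p) * norm p * exp (\<theta> * norm p))" by (rule ennreal_leI)
  qed
  also have "\<dots> = (\<integral>\<^sup>+r. ennreal (4 * pi * r\<^sup>2 * indicator {0..} r) * ennreal (U t r * r * exp (\<theta> * r)) \<partial>lborel)"
    by (rule nn_integral_norm_R3) measurable
  also have "\<dots> = (\<integral>\<^sup>+r. h r \<partial>lborel)"
  proof (rule nn_integral_cong)
    fix r show "ennreal (4 * pi * r\<^sup>2 * indicator {0..} r) * ennreal (U t r * r * exp (\<theta> * r)) = h r"
      by (cases "0 < r") (simp_all add: h_def u_zero u_nonneg ennreal_mult[symmetric] power_numeral_reduce mult_ac)
  qed
  \<comment> \<open>Monotone convergence in the cut-off N = n + 1, which is at least 1 as the
    estimates on E3 demand; at fixed r the truncated weight equals the full one as soon as N >=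
    r.\<close>
  also have "\<dots> \<le> ennreal (4 * pi * exp_bound h8 h3)"
  proof (rule LIMSEQ_le_const2)
    show "(\<lambda>n. \<integral>\<^sup>+r. hn n r \<partial>lborel) \<longlonglongrightarrow> (\<integral>\<^sup>+r. h r \<partial>lborel)"
    proof (rule nn_integral_LIMSEQ)
      show "incseq hn"
      proof (rule incseq_SucI, rule le_funI)
        fix n r show "hn n r \<le> hn (Suc n) r"
        proof (cases "0 < r")
          case True
          then show ?thesis unfolding hn_def gexp_def using \<theta>0
            by (intro ennreal_leI mult_left_mono u_nonneg iffD2[OF exp_le_cancel_iff]) auto
        qed (simp add: hn_def u_zero)
      qed
      show "hn n \<in> borel_measurable lborel" for n unfolding hn_def[abs_def] by measurable
      fix r :: real
      obtain n0 :: nat where n0: "r \<le> real n0" using real_arch_simple by blast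
      show "(\<lambda>n. hn n r) \<longlonglongrightarrow> h r"
      proof (rule tendsto_eventually, rule eventually_sequentiallyI)
        fix n assume "n0 \<le> n"
        then have "min r (real (Suc n)) = r" using n0 by (simp add: min_def)
        then show "hn n r = h r" unfolding hn_def h_def gexp_def by simp
      qed
    qed
    have "(\<integral>\<^sup>+r. hn n r \<partial>lborel) \<le> ennreal (4 * pi * exp_bound h8 h3)" for n
    proof -
      have I: "integrable lborel (\<lambda>r. U t r * (r ^ 3 * gexp \<theta> (real (Suc n)) r))"
        using E_integrable(1)[OF \<theta>0, of "real (Suc n)"] by simp
      have "(\<integral>\<^sup>+r. hn n r \<partial>lborel) = ennreal (\<integral>r. 4 * pi * (U t r * (r ^ 3 * gexp \<theta> (real (Suc n)) r)) \<partial>lborel)"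
        unfolding hn_def
      proof (rule nn_integral_eq_integral)
        show "AE r in lborel. 0 \<le> 4 * pi * (U t r * (r ^ 3 * gexp \<theta> (real (Suc n)) r))"
        proof (rule AE_I2)
          fix r show "0 \<le> 4 * pi * (U t r * (r ^ 3 * gexp \<theta> (real (Suc n)) r))"
            using u_zero[of r] u_nonneg[of r] gexp_pos[of \<theta> "real (Suc n)" r] by (cases "0 < r") auto
        qed
      qed (use I in simp)
      also have "\<dots> = ennreal (4 * pi * E3 \<theta> (real (Suc n)))" by (simp add: E3_def)
      also have "\<dots> \<le> ennreal (4 * pi * exp_bound h8 h3)"
        using E3_uniform[OF t, of "real (Suc n)"] unfolding \<theta>_def
        by (intro ennreal_leI mult_left_mono) auto
      finally show ?thesis .
    qed
    then show "\<exists>n. \<forall>k\<ge>n. (\<integral>\<^sup>+r. hn k r \<partial>lborel) \<le> ennreal (4 * pi * exp_bound h8 h3)" by blast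
  qed
  also have "\<dots> \<le> ennreal (1 / (2 * a))"
  proof (rule ennreal_leI)
    have "a * (8 * pi * exp_bound h8 h3) \<le> 1"
      using a(2) constants(8) by (simp add: pos_le_divide_eq)
    then show "4 * pi * exp_bound h8 h3 \<le> 1 / (2 * a)"
      using a0 by (simp add: pos_le_divide_eq mult_ac)
  qed
  finally show "(\<integral>\<^sup>+p. ennreal (f t (norm p) * norm p * exp (a * min 1 (t powr (1/5)) * norm p)) \<partial>(lborel :: (real^3) measure))
       \<le> ennreal (1 / (2 * a))" .
qed

end

theorem theorem7p2:
  fixes \<kappa>\<^sub>0 C\<^sub>8 c\<^sub>8 C :: real and hinf :: "real \<Rightarrow> real \<Rightarrow> real"
  assumes "0 < \<kappa>\<^sub>0"
    and "m8_constants C\<^sub>8 c\<^sub>8"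
    and "m4_constant C"
  shows "\<exists>\<alpha> :: real \<Rightarrow> real \<Rightarrow> real \<Rightarrow> real \<Rightarrow> real.
    \<forall>h3 \<delta> n0 f0 f nc.
      0 < h3 \<longrightarrow> 0 < \<delta> \<longrightarrow> 0 < n0 \<longrightarrow>
      (let h8 = h_8 \<kappa>\<^sub>0 C\<^sub>8 c\<^sub>8 \<delta> h3
       in solution \<kappa>\<^sub>0 (S_set h3 h8 (hinf h3 h8)) {0..} f0 n0 f nc) \<longrightarrow>
      n0 \<ge> threshold C f0 - moment 2 f0 + \<delta> \<longrightarrow>
      (let a = \<alpha> (moment 2 f0) (moment 3 f0) n0 \<delta>
       in 0 < a \<and>
          (\<forall>t>0. (\<integral>\<^sup>+p. ennreal (f t (norm p) * norm p
                     * exp (a * min 1 (t powr (1/5)) * norm p)) \<partial>(lborel :: (real^3) measure))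
                  \<le> ennreal (1 / (2 * a))))"
proof (rule exI[where x = "\<lambda>m2 h3 n0 \<delta>. exp_rate \<kappa>\<^sub>0 (h_8 \<kappa>\<^sub>0 C\<^sub>8 c\<^sub>8 \<delta> h3) m2 h3 n0"], intro allI impI)
  fix h3 \<delta> n0 f0 f nc
  assume pos: "0 < h3" "0 < n0" and sol: "let h8 = h_8 \<kappa>\<^sub>0 C\<^sub>8 c\<^sub>8 \<delta> h3
       in solution \<kappa>\<^sub>0 (S_set h3 h8 (hinf h3 h8)) {0..} f0 n0 f nc"
  define h8 where "h8 = h_8 \<kappa>\<^sub>0 C\<^sub>8 c\<^sub>8 \<delta> h3"
  interpret kinetic \<kappa>\<^sub>0 h3 h8 "hinf h3 h8" n0 f0 f nc
    using assms(1) pos sol by unfold_locales (simp_all add: Let_def h8_def)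
  \<comment> \<open>The witness receives the third moment of the initial datum and forms
    \<open>h_8\<close> from it and \<delta>; this equation identifies that value with the
    \<open>h8\<close> of the solution space.\<close>
  have "moment 3 f0 = h3" using f_in[of 0] f_0 by (simp add: S_set_def)
  then show "let a = exp_rate \<kappa>\<^sub>0 (h_8 \<kappa>\<^sub>0 C\<^sub>8 c\<^sub>8 \<delta> (moment 3 f0)) (moment 2 f0) (moment 3 f0) n0
       in 0 < a \<and> (\<forall>t>0. (\<integral>\<^sup>+p. ennreal (f t (norm p) * norm p
                     * exp (a * min 1 (t powr (1/5)) * norm p)) \<partial>(lborel :: (real^3) measure))
                  \<le> ennreal (1 / (2 * a)))"
    using exp_moment(1)[of 1] exp_moment(2) unfolding h8_def Let_def by simp
qed

end
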